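(* There exists a one-parameter family $\{\Sigma^b\}_{0\le b\le1}$ inside $B^3$ with the following properties: 1. $\Sigma^0$ is the vertical geodesic of $B^3$; 2. $\Sigma^b$ is a piece of a catenoidal-Ricci surface meeting $\partial B^3$ orthogonally for $0<b\le1$; 3. $\Sigma^1$ is the critical catenoid.
   Context: $B^3$ is the unit Euclidean three-dimensional ball centred at the origin of $\mathbb{R}^3$. The vertical geodesic of $B^3$ is the segment of the $z$-axis contained in $B^3$. A compact surface $\Sigma$ with non-empty smooth boundary lies inside $B^3$ and meets $\partial B^3$ orthogonally if $\mathrm{int}(\Sigma)\subset\mathrm{int}(B^3)$, $\partial\Sigma\subset\partial B^3$, and the unit conormal exterior to $\Sigma$ along $\partial\Sigma$ coincides with the position vector. If moreover $\Sigma$ is minimal it is a free boundary minimal surface in $B^3$. The critical catenoid is the piece of a catenoid, unique up to isometries of $B^3$, that is a free boundary minimal surface in $B^3$. Rotational surfaces: given smooth $f,g:I\to\mathbb{R}$ on an interval $I$ with $f>0$, $(f')^2+(g')^2=1$, $g'\ge0$, the rotational surface $\Sigma_f$ is parametrised by $X(s,\theta)=(f(s)\cos\theta,f(s)\sin\theta,g(s))$; it is determined by $f$ up to a vertical isometry of $\mathbb{R}^3$. A catenoidal-Ricci surface is a rotational surface $\Sigma_f$ with $f:\mathbb{R}\to\mathbb{R}$, $f(s)=\sqrt{bs^2+2cs+d}$, where $b,c,d\in\mathbb{R}$, $0<b\le1$ and $c^2<bd$; it is denoted by $\mathcal{C}_b(r)$, where $r>0$ is given by $r^2=\frac{bd-c^2}{b}$.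 *)

theory Defs
  imports "HOL-Analysis.Analysis"
begin

section \<open>Smooth maps on open sets\<close>

primrec Ck_on :: "nat \<Rightarrow> ('a::euclidean_space \<Rightarrow> 'b::real_normed_vector) \<Rightarrow> 'a set \<Rightarrow> bool" where
  "Ck_on 0 f U \<longleftrightarrow> continuous_on U f"
| "Ck_on (Suc n) f U \<longleftrightarrow>
     (\<forall>u\<in>U. f differentiable at u) \<and> (\<forall>v. Ck_on n (\<lambda>u. frechet_derivative f (at u) v) U)"

text \<open>\<open>C\<^sup>\<infinity>\<close> regularity; the derivatives are two-sided, so this is meant for open \<open>U\<close>.\<close>
definition smooth_on :: "('a::euclidean_space \<Rightarrow> 'b::real_normed_vector) \<Rightarrow> 'a set \<Rightarrow> bool" where
  "smooth_on f U \<longleftrightarrow> (\<forall>n. Ck_on n f U)"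


section \<open>Compact surfaces with boundary in Euclidean three-space\<close>

abbreviation half_plane :: "(real \<times> real) set" where
  "half_plane \<equiv> {u. snd u \<ge> 0}"

abbreviation edge :: "(real \<times> real) set" where
  "edge \<equiv> {u. snd u = 0}"

text \<open>
  \<open>X\<close> is a smooth immersion of the open set \<open>U\<close> whose restriction to \<open>U \<inter> H\<close> is a homeomorphism
  onto a relatively open part of \<open>S\<close>.  The model set \<open>H\<close> is the whole plane for an interior
  chart and the closed upper half plane for a boundary chart; in the latter case \<open>X\<close> is a smooth
  extension across the edge.
\<close>
definition local_chart ::
  "(real^3) set \<Rightarrow> (real \<times> real) set \<Rightarrow> (real \<times> real) set \<Rightarrow> (real \<times> real \<Rightarrow> real^3) \<Rightarrow> bool" where
  "local_chart S H U X \<longleftrightarrow>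
     open U \<and> smooth_on X U \<and> (\<forall>u\<in>U. inj (frechet_derivative X (at u))) \<and>
     openin (top_of_set S) (X ` (U \<inter> H)) \<and>
     (\<exists>Y. homeomorphism (U \<inter> H) (X ` (U \<inter> H)) X Y)"

definition surface_boundary :: "(real^3) set \<Rightarrow> (real^3) set" where
  "surface_boundary S = {p. \<exists>U X u. local_chart S half_plane U X \<and> u \<in> U \<inter> edge \<and> X u = p}"

definition surface_interior :: "(real^3) set \<Rightarrow> (real^3) set" where
  "surface_interior S = S - surface_boundary S"

definition compact_surface :: "(real^3) set \<Rightarrow> bool" where
  "compact_surface S \<longleftrightarrow> compact S \<and> connected S \<and> S \<noteq> {} \<and>
     (\<forall>p\<in>S. \<exists>H\<in>{UNIV, half_plane}. \<exists>U X. local_chart S H U X \<and> p \<in> X ` (U \<inter> H))"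

text \<open>
  In a boundary chart the image of \<open>(1, 0)\<close> under the differential spans the tangent line of the
  boundary, and images of vectors with negative second component point out of the surface.  The
  resulting vector does not depend on the chart.
\<close>
definition exterior_unit_conormal :: "(real^3) set \<Rightarrow> real^3 \<Rightarrow> real^3 \<Rightarrow> bool" where
  "exterior_unit_conormal S p \<nu> \<longleftrightarrow>
     (\<exists>U X u w. local_chart S half_plane U X \<and> u \<in> U \<inter> edge \<and> X u = p \<and>
        snd w < 0 \<and> \<nu> = frechet_derivative X (at u) w \<and>
        norm \<nu> = 1 \<and> \<nu> \<bullet> frechet_derivative X (at u) (1, 0) = 0)"

definition meets_unit_sphere_orthogonally :: "(real^3) set \<Rightarrow> bool" where
  "meets_unit_sphere_orthogonally S \<longleftrightarrow>
     compact_surface S \<and> surface_boundary S \<noteq> {} \<and>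
     surface_interior S \<subseteq> ball 0 1 \<and> surface_boundary S \<subseteq> sphere 0 1 \<and>
     (\<forall>p\<in>surface_boundary S. exterior_unit_conormal S p p)"


section \<open>Minimal surfaces\<close>

definition partial1 :: "(real \<times> real \<Rightarrow> real^3) \<Rightarrow> real \<times> real \<Rightarrow> real^3" where
  "partial1 X u = frechet_derivative X (at u) (1, 0)"

definition partial2 :: "(real \<times> real \<Rightarrow> real^3) \<Rightarrow> real \<times> real \<Rightarrow> real^3" where
  "partial2 X u = frechet_derivative X (at u) (0, 1)"

definition unit_normal :: "(real \<times> real \<Rightarrow> real^3) \<Rightarrow> real \<times> real \<Rightarrow> real^3" where
  "unit_normal X u = sgn (cross3 (partial1 X u) (partial2 X u))"

definition mean_curvature :: "(real \<times> real \<Rightarrow> real^3) \<Rightarrow> real \<times> real \<Rightarrow> real" where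
  "mean_curvature X u =
     (let E = partial1 X u \<bullet> partial1 X u;
          F = partial1 X u \<bullet> partial2 X u;
          G = partial2 X u \<bullet> partial2 X u;
          N = unit_normal X u;
          L = partial1 (partial1 X) u \<bullet> N;
          M = partial2 (partial1 X) u \<bullet> N;
          P = partial2 (partial2 X) u \<bullet> N
      in (L * G - 2 * M * F + P * E) / (2 * (E * G - F\<^sup>2)))"

text \<open>Up to sign the mean curvature is independent of the chart, so one chart around each point
  is enough.\<close>
definition minimal_surface :: "(real^3) set \<Rightarrow> bool" where
  "minimal_surface S \<longleftrightarrow>
     (\<forall>p\<in>S. \<exists>H\<in>{UNIV, half_plane}. \<exists>U X. local_chart S H U X \<and> p \<in> X ` (U \<inter> H) \<and>
        (\<forall>u\<in>U \<inter> H. mean_curvature X u = 0))"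

definition free_boundary_minimal :: "(real^3) set \<Rightarrow> bool" where
  "free_boundary_minimal S \<longleftrightarrow> meets_unit_sphere_orthogonally S \<and> minimal_surface S"


section \<open>Catenoids and the critical catenoid\<close>

definition catenoid :: "(real^3) set \<Rightarrow> bool" where
  "catenoid C \<longleftrightarrow>
     (\<exists>a>0. \<exists>T :: real^3 \<Rightarrow> real^3. (\<forall>x y. dist (T x) (T y) = dist x y) \<and>
        C = T ` {x. sqrt ((x $ 1)\<^sup>2 + (x $ 2)\<^sup>2) = a * cosh (x $ 3 / a)})"

text \<open>The critical catenoid is only determined up to isometries of the ball, hence a predicate.\<close>
definition critical_catenoid :: "(real^3) set \<Rightarrow> bool" where
  "critical_catenoid S \<longleftrightarrow> (\<exists>C. catenoid C \<and> S \<subseteq> C) \<and> free_boundary_minimal S"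


section \<open>Rotational and catenoidal-Ricci surfaces\<close>

definition rotational_profile :: "real set \<Rightarrow> (real \<Rightarrow> real) \<Rightarrow> (real \<Rightarrow> real) \<Rightarrow> bool" where
  "rotational_profile I f g \<longleftrightarrow>
     open I \<and> is_interval I \<and> smooth_on f I \<and> smooth_on g I \<and>
     (\<forall>s\<in>I. f s > 0 \<and> (deriv f s)\<^sup>2 + (deriv g s)\<^sup>2 = 1 \<and> deriv g s \<ge> 0)"

definition rotational_surface :: "real set \<Rightarrow> (real \<Rightarrow> real) \<Rightarrow> (real \<Rightarrow> real) \<Rightarrow> (real^3) set" where
  "rotational_surface I f g =
     {vector [f s * cos \<theta>, f s * sin \<theta>, g s] | s \<theta>. s \<in> I}"

text \<open>\<open>catenoidal_ricci b r C\<close>: the set \<open>C\<close> is a copy of the surface with parameters \<open>b\<close> and \<open>r\<close>.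
  It is a relation because \<open>g\<close> is determined by \<open>f\<close> only up to an additive constant.\<close>
definition catenoidal_ricci :: "real \<Rightarrow> real \<Rightarrow> (real^3) set \<Rightarrow> bool" where
  "catenoidal_ricci b r C \<longleftrightarrow>
     (\<exists>c d f g. 0 < b \<and> b \<le> 1 \<and> c\<^sup>2 < b * d \<and> 0 < r \<and> r\<^sup>2 = (b * d - c\<^sup>2) / b \<and>
        f = (\<lambda>s. sqrt (b * s\<^sup>2 + 2 * c * s + d)) \<and>
        rotational_profile UNIV f g \<and> C = rotational_surface UNIV f g)"


section \<open>The unit ball and families of subsets\<close>

definition vertical_geodesic :: "(real^3) set" where
  "vertical_geodesic = {x \<in> cball 0 1. x $ 1 = 0 \<and> x $ 2 = 0}"

text \<open>Continuity with respect to the Hausdorff distance, so that a family of surfaces may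
  degenerate to a curve.\<close>
definition hausdorff_continuous_on :: "real set \<Rightarrow> (real \<Rightarrow> (real^3) set) \<Rightarrow> bool" where
  "hausdorff_continuous_on A \<Sigma> \<longleftrightarrow>
     (\<forall>b\<in>A. \<forall>\<epsilon>>0. \<exists>\<delta>>0. \<forall>b'\<in>A. \<bar>b' - b\<bar> < \<delta> \<longrightarrow>
        \<Sigma> b' \<subseteq> (\<Union>x\<in>\<Sigma> b. ball x \<epsilon>) \<and> \<Sigma> b \<subseteq> (\<Union>x\<in>\<Sigma> b'. ball x \<epsilon>))"

end

theory Submission
  imports Defs
begin

text \<open>Up to scaling and translation, the profile curve of a catenoidal-Ricci surface with parameter \<open>b\<close>
  is \<open>(sqrt b * sqrt (1 + x\<^sup>2), height b x)\<close>, where \<open>height b\<close> is the odd (elliptic) primitive of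
  \<open>sqrt (1 + (1 - b) * x\<^sup>2) / sqrt (1 + x\<^sup>2)\<close>.  The tangent line at \<open>x > 0\<close> meets the axis at a height
  that increases strictly with \<open>x\<close>, from negative to positive values, so it passes through the origin for a
  unique \<open>x = extent b\<close>, which depends continuously on \<open>b > 0\<close>.  Cutting the curve at
  \<open>x = - extent b\<close> and \<open>x = extent b\<close> and scaling the end points to the unit circle gives the free boundary
  surface.  There the position vector equals the unit tangent, whence the distance to the axis is
  at most \<open>sqrt b\<close> and the end points have height at least \<open>1 - b\<close> in absolute value; hence the surfaces
  converge to the vertical segment as \<open>b\<close> tends to \<open>0\<close>.  For \<open>b = 1\<close> the primitive is \<open>arsinh\<close> and the curve
  is a catenary.\<close>

section \<open>Calculus of smooth maps\<close>

lemma Ck_on_cong: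
  assumes "open U" "\<And>u. u \<in> U \<Longrightarrow> f u = g u" "Ck_on n f U"
  shows "Ck_on n g U"
  using assms(2,3)
proof (induction n arbitrary: f g)
  case 0
  then show ?case using continuous_on_cong by force
next
  case (Suc n)
  have D: "(g has_derivative frechet_derivative f (at u)) (at u)" if u: "u \<in> U" for u
  proof (rule has_derivative_transform_within_open[OF _ assms(1) u])
    show "(f has_derivative frechet_derivative f (at u)) (at u)"
      using Suc.prems(2) u by (auto simp: frechet_derivative_works)
  qed (use Suc.prems(1) in auto)
  have "Ck_on n (\<lambda>u. frechet_derivative g (at u) v) U" for v
  proof (rule Suc.IH)
    show "Ck_on n (\<lambda>u. frechet_derivative f (at u) v) U" using Suc.prems(2) by auto
  qed (simp add: frechet_derivative_at[OF D, symmetric])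
  then show ?case using D by (auto simp: differentiable_def)
qed

text \<open>Trades the chosen \<open>frechet_derivative\<close> for an explicit differential
  \<open>D\<close>: derivatives are unique and \<open>U\<close> is open, so the directional
  derivatives agree on \<open>U\<close>.\<close>

lemma Ck_on_SucI:
  assumes "open U" "\<And>u. u \<in> U \<Longrightarrow> (f has_derivative D u) (at u)"
    and "\<And>v. Ck_on n (\<lambda>u. D u v) U"
  shows "Ck_on (Suc n) f U"
proof -
  have "Ck_on n (\<lambda>u. frechet_derivative f (at u) v) U" for v
    by (rule Ck_on_cong[OF assms(1) _ assms(3)]) (simp add: frechet_derivative_at[OF assms(2), symmetric])
  then show ?thesis using assms(2) by (auto simp: differentiable_def)
qed

lemma Ck_on_Suc_has_derivative:
  assumes "Ck_on (Suc n) f U" "u \<in> U"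
  shows "(f has_derivative frechet_derivative f (at u)) (at u)"
  using assms by (auto simp: frechet_derivative_works)

text \<open>The recursion constrains the derivatives only, so lower regularity of the map itself has
  to be proved; it starts from the continuity of differentiable maps.\<close>

lemma Ck_on_Suc_lower:
  assumes "Ck_on (Suc n) f U"
  shows "Ck_on n f U"
  using assms
proof (induction n arbitrary: f)
  case 0
  then show ?case
    by (auto intro!: continuous_at_imp_continuous_on differentiable_imp_continuous_within)
next
  case (Suc n)
  then show ?case by (subst Ck_on.simps) (auto simp del: Ck_on.simps simp: Ck_on.simps(2)[of "Suc n"])
qed

lemma Ck_on_subset: "Ck_on n f V \<Longrightarrow> U \<subseteq> V \<Longrightarrow> Ck_on n f U"
  by (induction n arbitrary: f) (auto intro: continuous_on_subset)

lemma Ck_on_const: "Ck_on n (\<lambda>u. c) U"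
  by (induction n arbitrary: c) (auto simp: frechet_derivative_const)

lemma Ck_on_bounded_linear_compose:
  assumes "open U" "bounded_linear L" "Ck_on n f U"
  shows "Ck_on n (\<lambda>u. L (f u)) U"
  using assms(3)
proof (induction n arbitrary: f)
  case 0
  then show ?case
    using bounded_linear.continuous_on[OF assms(2)] by auto
next
  case (Suc n)
  show ?case
  proof (rule Ck_on_SucI[OF assms(1)])
    show "((\<lambda>u. L (f u)) has_derivative (\<lambda>v. L (frechet_derivative f (at u) v))) (at u)"
      if "u \<in> U" for u
      by (rule bounded_linear.has_derivative[OF assms(2) Ck_on_Suc_has_derivative[OF Suc.prems that]])
    show "Ck_on n (\<lambda>u. L (frechet_derivative f (at u) v)) U" for v
      using Suc by auto
  qed
qed

lemma Ck_on_ident: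
  assumes "open U"
  shows "Ck_on n (\<lambda>u. u) U"
proof (cases n)
  case 0
  then show ?thesis by (simp add: continuous_on_id)
next
  case (Suc m)
  show ?thesis unfolding Suc
  proof (rule Ck_on_SucI[where D = "\<lambda>u v. v", OF assms])
    show "((\<lambda>u. u) has_derivative (\<lambda>v. v)) (at x)" for x :: 'a
      by (rule has_derivative_ident)
    show "Ck_on m (\<lambda>u::'a. v) U" for v :: 'a
      by (rule Ck_on_const)
  qed
qed

lemma Ck_on_add:
  assumes "open U" "Ck_on n f U" "Ck_on n g U"
  shows "Ck_on n (\<lambda>u. f u + g u) U"
  using assms(2,3)
proof (induction n arbitrary: f g)
  case 0
  then show ?case by (simp add: continuous_on_add)
next
  case (Suc n)
  show ?case
  proof (rule Ck_on_SucI[OF assms(1)])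
    show "((\<lambda>u. f u + g u) has_derivative
      (\<lambda>v. frechet_derivative f (at u) v + frechet_derivative g (at u) v)) (at u)" if "u \<in> U" for u
      by (rule has_derivative_add[OF Ck_on_Suc_has_derivative[OF Suc.prems(1) that]
            Ck_on_Suc_has_derivative[OF Suc.prems(2) that]])
    show "Ck_on n (\<lambda>u. frechet_derivative f (at u) v + frechet_derivative g (at u) v) U" for v
      by (rule Suc.IH) (use Suc.prems in auto)
  qed
qed

lemma Ck_on_mult:
  fixes f g :: "_ \<Rightarrow> real"
  assumes "open U" "Ck_on n f U" "Ck_on n g U"
  shows "Ck_on n (\<lambda>u. f u * g u) U"
  using assms(2,3)
proof (induction n arbitrary: f g)
  case 0
  then show ?case by (simp add: continuous_on_mult)
next
  case (Suc n)
  show ?case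
  proof (rule Ck_on_SucI[OF assms(1)])
    show "((\<lambda>u. f u * g u) has_derivative
      (\<lambda>v. f u * frechet_derivative g (at u) v + frechet_derivative f (at u) v * g u)) (at u)"
      if "u \<in> U" for u
      by (rule has_derivative_mult[OF Ck_on_Suc_has_derivative[OF Suc.prems(1) that]
            Ck_on_Suc_has_derivative[OF Suc.prems(2) that]])
    show "Ck_on n (\<lambda>u. f u * frechet_derivative g (at u) v + frechet_derivative f (at u) v * g u) U" for v
      \<comment> \<open>The product rule leaves undifferentiated factors, whose class is first
        lowered to \<open>n\<close>.\<close>
      by (intro Ck_on_add assms(1) Suc.IH Ck_on_Suc_lower[OF Suc.prems(1)]
          Ck_on_Suc_lower[OF Suc.prems(2)]) (use Suc.prems in auto)
  qed
qed

lemma Ck_on_real_SucI: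
  fixes h :: "real \<Rightarrow> real"
  assumes "open V" "\<And>x. x \<in> V \<Longrightarrow> (h has_real_derivative h' x) (at x)" "Ck_on n h' V"
  shows "Ck_on (Suc n) h V"
proof (rule Ck_on_SucI[OF assms(1)])
  show "(h has_derivative (\<lambda>v. h' x * v)) (at x)" if "x \<in> V" for x
    using assms(2)[OF that] by (simp add: has_field_derivative_def)
  show "Ck_on n (\<lambda>x. h' x * v) V" for v
    by (intro Ck_on_mult assms Ck_on_const)
qed

text \<open>By the chain rule each directional derivative is a product of a derivative of
  \<open>f\<close> and \<open>?h'\<close> after \<open>f\<close>; the induction hypothesis covers
  the second factor because \<open>h\<close> is generalised.\<close>

lemma Ck_on_compose:
  fixes h :: "real \<Rightarrow> real"
  assumes "open U" "open V" "Ck_on n h V" "Ck_on n f U" "f ` U \<subseteq> V"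
  shows "Ck_on n (\<lambda>u. h (f u)) U"
  using assms(3,4)
proof (induction n arbitrary: h)
  case 0
  then show ?case using continuous_on_compose2[OF _ _ assms(5)] by auto
next
  case (Suc n)
  show ?case
  proof (rule Ck_on_SucI[OF assms(1)])
    let ?h' = "\<lambda>x. frechet_derivative h (at x) 1"
    fix u assume u: "u \<in> U"
    then have h: "(h has_derivative frechet_derivative h (at (f u))) (at (f u))"
      using assms(5) by (intro Ck_on_Suc_has_derivative[OF Suc.prems(1)]) auto
    \<comment> \<open>A linear map of the real line is multiplication by its value at 1.\<close>
    have "frechet_derivative h (at (f u)) = (\<lambda>v. v * ?h' (f u))"
    proof
      show "frechet_derivative h (at (f u)) v = v * ?h' (f u)" for v
        using linear.scaleR[OF has_derivative_linear[OF h], of v 1] by simp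
    qed
    then have "(h has_derivative (\<lambda>v. v * ?h' (f u))) (at (f u))"
      by (rule has_derivative_eq_rhs[OF h])
    then show "((\<lambda>u. h (f u)) has_derivative (\<lambda>v. frechet_derivative f (at u) v * ?h' (f u))) (at u)"
      by (rule has_derivative_compose[OF Ck_on_Suc_has_derivative[OF Suc.prems(2) u]])
  next
    fix v
    have "Ck_on n (\<lambda>x. frechet_derivative h (at x) 1) V"
      using Suc.prems(1) by simp
    then have "Ck_on n (\<lambda>u. frechet_derivative h (at (f u)) 1) U"
      by (rule Suc.IH[OF _ Ck_on_Suc_lower[OF Suc.prems(2)]])
    moreover have "Ck_on n (\<lambda>u. frechet_derivative f (at u) v) U"
      using Suc.prems(2) by simp
    ultimately show "Ck_on n (\<lambda>u. frechet_derivative f (at u) v * frechet_derivative h (at (f u)) 1) U"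
      using Ck_on_mult[OF assms(1)] by blast
  qed
qed

section \<open>Smooth maps and the elementary functions\<close>

lemma smooth_on_real_primitive:
  fixes h :: "real \<Rightarrow> real"
  assumes "open V" "\<And>x. x \<in> V \<Longrightarrow> (h has_real_derivative h' x) (at x)" "smooth_on h' V"
  shows "smooth_on h V"
  unfolding smooth_on_def using Ck_on_real_SucI[OF assms(1,2)] assms(3) Ck_on_Suc_lower
  by (metis smooth_on_def)

lemma smooth_on_const: "smooth_on (\<lambda>u. c) U"
  by (simp add: smooth_on_def Ck_on_const)

lemma smooth_on_ident: "open U \<Longrightarrow> smooth_on (\<lambda>u. u) U"
  by (simp add: smooth_on_def Ck_on_ident)

lemma smooth_on_bounded_linear_compose:
  "open U \<Longrightarrow> bounded_linear L \<Longrightarrow> smooth_on f U \<Longrightarrow> smooth_on (\<lambda>u. L (f u)) U"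
  by (simp add: smooth_on_def Ck_on_bounded_linear_compose)

lemma smooth_on_add:
  "open U \<Longrightarrow> smooth_on f U \<Longrightarrow> smooth_on g U \<Longrightarrow> smooth_on (\<lambda>u. f u + g u) U"
  by (simp add: smooth_on_def Ck_on_add)

lemma smooth_on_mult:
  fixes f g :: "_ \<Rightarrow> real"
  shows "open U \<Longrightarrow> smooth_on f U \<Longrightarrow> smooth_on g U \<Longrightarrow> smooth_on (\<lambda>u. f u * g u) U"
  by (simp add: smooth_on_def Ck_on_mult)

lemma smooth_on_compose:
  fixes h :: "real \<Rightarrow> real"
  assumes "open U" "open V" "smooth_on h V" "smooth_on f U" "f ` U \<subseteq> V"
  shows "smooth_on (\<lambda>u. h (f u)) U"
  using assms Ck_on_compose unfolding smooth_on_def by blast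

lemma smooth_on_subset: "smooth_on f V \<Longrightarrow> U \<subseteq> V \<Longrightarrow> smooth_on f U"
  using Ck_on_subset unfolding smooth_on_def by blast

lemma smooth_on_imp_continuous_on: "smooth_on f U \<Longrightarrow> continuous_on U f"
  unfolding smooth_on_def using Ck_on.simps(1) by blast

text \<open>Sine and cosine are derivatives of each other up to sign, so one induction on the class
  treats both.\<close>

lemma smooth_on_sin: "smooth_on (sin :: real \<Rightarrow> real) UNIV"
  and smooth_on_cos: "smooth_on (cos :: real \<Rightarrow> real) UNIV"
proof -
  have "Ck_on n (sin :: real \<Rightarrow> real) UNIV \<and> Ck_on n (cos :: real \<Rightarrow> real) UNIV" for n
  proof (induction n)
    case 0
    then show ?case by (simp add: continuous_on_sin continuous_on_cos)
  next
    case (Suc n)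
    have "Ck_on (Suc n) (sin :: real \<Rightarrow> real) UNIV"
      by (rule Ck_on_real_SucI[where h' = cos]) (use Suc in \<open>auto intro: DERIV_sin\<close>)
    moreover have "Ck_on (Suc n) (cos :: real \<Rightarrow> real) UNIV"
      by (rule Ck_on_real_SucI[where h' = "\<lambda>x. - sin x"])
        (use Suc in \<open>auto intro!: DERIV_cos Ck_on_bounded_linear_compose[where L = uminus] bounded_linear_minus bounded_linear_ident\<close>)
    ultimately show ?case by blast
  qed
  then show "smooth_on (sin :: real \<Rightarrow> real) UNIV" "smooth_on (cos :: real \<Rightarrow> real) UNIV"
    by (simp_all add: smooth_on_def)
qed

text \<open>The derivative is a multiple of the square of \<open>inverse\<close> itself, so the
  product rule closes the induction.\<close>

lemma smooth_on_inverse: "smooth_on (inverse :: real \<Rightarrow> real) {0<..}"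
proof -
  have "Ck_on n (inverse :: real \<Rightarrow> real) {0<..}" for n
  proof (induction n)
    case 0
    then show ?case by (auto intro!: continuous_intros)
  next
    case (Suc n)
    show ?case
    proof (rule Ck_on_real_SucI[where h' = "\<lambda>x. (-1) * (inverse x * inverse x)"])
      show "(inverse has_real_derivative (-1) * (inverse x * inverse x)) (at x)"
        if "x \<in> {0<..}" for x :: real
        using that by (auto intro!: derivative_eq_intros)
    qed (intro Ck_on_mult Ck_on_const Suc open_greaterThan)+
  qed
  then show ?thesis by (simp add: smooth_on_def)
qed

text \<open>The derivative is half of \<open>inverse\<close> after \<open>sqrt\<close>, so class
  \<open>n\<close> of \<open>sqrt\<close> yields class \<open>Suc n\<close>.\<close>

lemma smooth_on_sqrt: "smooth_on sqrt {0<..}"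
proof -
  have "Ck_on n sqrt {0<..}" for n
  proof (induction n)
    case 0
    then show ?case by (auto intro!: continuous_intros)
  next
    case (Suc n)
    show ?case
    proof (rule Ck_on_real_SucI[where h' = "\<lambda>x. inverse (sqrt x) * (1/2)"])
      show "(sqrt has_real_derivative inverse (sqrt x) * (1/2)) (at x)"
        if "x \<in> {0<..}" for x :: real
        using that by (auto intro!: derivative_eq_intros)
      have "Ck_on n (\<lambda>x. inverse (sqrt x)) {0<..}"
        by (rule Ck_on_compose[OF open_greaterThan open_greaterThan[of 0] _ Suc])
          (use smooth_on_inverse in \<open>auto simp: smooth_on_def\<close>)
      then show "Ck_on n (\<lambda>x. inverse (sqrt x) * (1/2)) {0<..}"
        using Ck_on_mult[OF open_greaterThan _ Ck_on_const] by blast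
    qed auto
  qed
  then show ?thesis by (simp add: smooth_on_def)
qed

section \<open>Rotational bands\<close>

definition rot :: "(real \<Rightarrow> real) \<Rightarrow> (real \<Rightarrow> real) \<Rightarrow> real \<times> real \<Rightarrow> real^3" where
  "rot f g u = vector [f (snd u) * cos (fst u), f (snd u) * sin (fst u), g (snd u)]"

lemma rot_nth [simp]:
  "rot f g (\<theta>, s) $ 1 = f s * cos \<theta>" "rot f g (\<theta>, s) $ 2 = f s * sin \<theta>" "rot f g (\<theta>, s) $ 3 = g s"
  by (simp_all add: rot_def)

text \<open>With the constant vectors split off, the rules for sums and scalings apply to
  \<open>vector\<close>.\<close>

lemma vector3_eq_axis:
  "vector [x, y, z] = x *\<^sub>R axis 1 1 + y *\<^sub>R axis 2 1 + (z *\<^sub>R axis 3 1 :: real^3)"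
  by (simp add: vec_eq_iff forall_3 axis_def)

lemma vec3_eq_iff: "(x :: 'a^3) = y \<longleftrightarrow> x $ 1 = y $ 1 \<and> x $ 2 = y $ 2 \<and> x $ 3 = y $ 3"
  by (simp add: vec_eq_iff forall_3)

lemma inner_vec3: "(x :: real^3) \<bullet> y = x $ 1 * y $ 1 + x $ 2 * y $ 2 + x $ 3 * y $ 3"
  by (simp add: inner_vec_def sum_3)

lemma has_derivative_vector3:
  assumes "(x has_derivative x') F" "(y has_derivative y') F" "(z has_derivative z') F"
  shows "((\<lambda>u. vector [x u, y u, z u] :: real^3) has_derivative (\<lambda>v. vector [x' v, y' v, z' v])) F"
  unfolding vector3_eq_axis by (intro has_derivative_add has_derivative_scaleR_left assms)

lemma smooth_on_vector3:
  assumes "open U" "smooth_on x U" "smooth_on y U" "smooth_on z U"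
  shows "smooth_on (\<lambda>u. vector [x u, y u, z u] :: real^3) U"
  unfolding vector3_eq_axis
  by (intro smooth_on_add assms(1) smooth_on_bounded_linear_compose[OF assms(1) bounded_linear_scaleR_left]
      assms)

lemma smooth_on_rot:
  assumes "smooth_on f UNIV" "smooth_on g UNIV"
  shows "smooth_on (rot f g) UNIV"
proof -
  have [simp]: "smooth_on (fst :: real \<times> real \<Rightarrow> real) UNIV" "smooth_on (snd :: real \<times> real \<Rightarrow> real) UNIV"
    using smooth_on_bounded_linear_compose[OF open_UNIV bounded_linear_fst smooth_on_ident[OF open_UNIV]]
      smooth_on_bounded_linear_compose[OF open_UNIV bounded_linear_snd smooth_on_ident[OF open_UNIV]]
    by simp_all
  have c: "smooth_on (\<lambda>u :: real \<times> real. h (snd u)) UNIV" "smooth_on (\<lambda>u :: real \<times> real. h (fst u)) UNIV"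
    if "smooth_on h UNIV" for h :: "real \<Rightarrow> real"
    by (rule smooth_on_compose[OF open_UNIV open_UNIV that]; simp)+
  show ?thesis unfolding rot_def[abs_def]
    by (intro smooth_on_vector3 smooth_on_mult c assms smooth_on_sin smooth_on_cos open_UNIV)
qed

text \<open>General angular factors \<open>x\<close>, \<open>y\<close> are allowed because
  \<open>rot\<close> and both of its first partial derivatives have this form; second derivatives
  then come from the same formula.\<close>

lemma has_derivative_separated:
  assumes f: "(f has_real_derivative f') (at s)" and g: "(g has_real_derivative g') (at s)"
    and x: "(x has_real_derivative x') (at \<theta>)" and y: "(y has_real_derivative y') (at \<theta>)"
  shows "((\<lambda>u. vector [f (snd u) * x (fst u), f (snd u) * y (fst u), g (snd u)] :: real^3) has_derivative
    (\<lambda>v. fst v *\<^sub>R vector [f s * x', f s * y', 0] + snd v *\<^sub>R vector [f' * x \<theta>, f' * y \<theta>, g']))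
    (at (\<theta>, s))"
proof -
  have S: "((\<lambda>u. h (snd u)) has_derivative (\<lambda>v. h' * snd v)) (at (\<theta>, s))"
    if "(h has_real_derivative h') (at s)" for h h'
    using has_derivative_compose[OF has_derivative_snd[OF has_derivative_ident], of h _ "(\<theta>, s)" UNIV] that
    by (simp add: has_field_derivative_def)
  have F: "((\<lambda>u. h (fst u)) has_derivative (\<lambda>v. h' * fst v)) (at (\<theta>, s))"
    if "(h has_real_derivative h') (at \<theta>)" for h h'
    using has_derivative_compose[OF has_derivative_fst[OF has_derivative_ident], of h _ "(\<theta>, s)" UNIV] that
    by (simp add: has_field_derivative_def)
  show ?thesis
    by (rule has_derivative_eq_rhs[OF has_derivative_vector3[OF has_derivative_mult[OF S[OF f] F[OF x]]
          has_derivative_mult[OF S[OF f] F[OF y]] S[OF g]]]) (auto simp: vec3_eq_iff algebra_simps)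
qed

lemma has_derivative_rot:
  assumes "(f has_real_derivative f') (at s)" "(g has_real_derivative g') (at s)"
  shows "(rot f g has_derivative (\<lambda>v. fst v *\<^sub>R vector [- f s * sin \<theta>, f s * cos \<theta>, 0]
      + snd v *\<^sub>R vector [f' * cos \<theta>, f' * sin \<theta>, g'])) (at (\<theta>, s))"
  using has_derivative_separated[OF assms DERIV_cos DERIV_sin] by (simp add: rot_def[abs_def])

lemma obtain_angle_near:
  fixes \<theta> \<theta>0 :: real
  assumes "cos (\<theta> - \<theta>0) > 0"
  obtains \<eta> where "\<eta> \<in> {\<theta>0 - pi/2<..<\<theta>0 + pi/2}" "cos \<eta> = cos \<theta>" "sin \<eta> = sin \<theta>"
proof
  \<comment> \<open>The representative of \<theta> - \<theta>0 in the open interval from -pi/2 to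
    pi/2; the positive cosine rules out the other solution of the sine equation.\<close>
  let ?y = "arcsin (sin (\<theta> - \<theta>0))"
  have "cos ?y = cos (\<theta> - \<theta>0)"
    using assms by (simp add: cos_arcsin sin_squared_eq)
  moreover have "sin ?y = sin (\<theta> - \<theta>0)" by simp
  ultimately show "cos (\<theta>0 + ?y) = cos \<theta>" "sin (\<theta>0 + ?y) = sin \<theta>"
    using cos_add[of \<theta>0 "\<theta> - \<theta>0"] cos_add[of \<theta>0 ?y] sin_add[of \<theta>0 "\<theta> - \<theta>0"] sin_add[of \<theta>0 ?y]
    by simp_all
  have "(sin (\<theta> - \<theta>0))\<^sup>2 < 1" using assms sin_cos_squared_add[of "\<theta> - \<theta>0"]
    by (smt (verit) zero_less_power)
  then have "- 1 < sin (\<theta> - \<theta>0)" "sin (\<theta> - \<theta>0) < 1"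
    by (simp_all add: abs_square_less_1 abs_less_iff)
  then show "\<theta>0 + ?y \<in> {\<theta>0 - pi/2<..<\<theta>0 + pi/2}"
    using arcsin_lt_bounded[of "sin (\<theta> - \<theta>0)"] by (auto simp del: arcsin_sin)
qed

text \<open>A boundary point of a chart is never interior for another chart: the transition map would
  be an open map (invariance of domain) into the half plane hitting its edge.\<close>

lemma surface_boundary_disjoint_interior_chart:
  assumes Z: "local_chart S UNIV V Z" and q: "q \<in> Z ` V"
  shows "q \<notin> surface_boundary S"
proof
  assume "q \<in> surface_boundary S"
  then obtain U X u where X: "local_chart S half_plane U X" and u: "u \<in> U" "snd u = 0" "X u = q"
    unfolding surface_boundary_def by auto
  obtain Y where Y: "homeomorphism (U \<inter> half_plane) (X ` (U \<inter> half_plane)) X Y"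
    and oX: "openin (top_of_set S) (X ` (U \<inter> half_plane))"
    using X unfolding local_chart_def by auto
  obtain Z' where Z': "homeomorphism V (Z ` V) Z Z'" and V: "open V" and ZV: "Z ` V \<subseteq> S"
    using Z openin_imp_subset unfolding local_chart_def by fastforce
  \<comment> \<open>The part of the interior chart that lands in the boundary chart, where the
    transition map \<open>Y \<circ> Z\<close> is defined; it is open because the boundary chart
    covers a relatively open part of \<open>S\<close>.\<close>
  define V' where "V' = V \<inter> Z -` (X ` (U \<inter> half_plane))"
  have cZ: "continuous_on V Z" using homeomorphism_cont1[OF Z'] .
  have "openin (top_of_set V) V'" unfolding V'_def
    by (rule continuous_openin_preimage[OF cZ _ oX]) (use ZV in auto)
  then have oV': "open V'" using V openin_open_eq by blast
  have V'V: "V' \<subseteq> V" and ZV': "Z ` V' \<subseteq> X ` (U \<inter> half_plane)" unfolding V'_def by auto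
  have "open ((Y \<circ> Z) ` V')"
  proof (rule invariance_of_domain[OF _ oV'])
    show "continuous_on V' (Y \<circ> Z)"
      by (rule continuous_on_compose[OF continuous_on_subset[OF cZ V'V]
            continuous_on_subset[OF homeomorphism_cont2[OF Y] ZV']])
    have "inj_on Z V'"
      by (rule inj_on_inverseI[of _ Z']) (use homeomorphism_apply1[OF Z'] V'V in auto)
    moreover have "inj_on Y (Z ` V')"
      by (rule inj_on_inverseI[of _ X]) (use homeomorphism_apply2[OF Y] ZV' in auto)
    ultimately show "inj_on (Y \<circ> Z) V'" by (rule comp_inj_on)
  qed
  moreover have "u \<in> (Y \<circ> Z) ` V'"
  proof -
    obtain v where v: "v \<in> V" "Z v = q" using q by auto
    then have "Z v \<in> X ` (U \<inter> half_plane)" using u by (intro image_eqI[of _ _ u]) auto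
    then have "v \<in> V'" using v unfolding V'_def by auto
    moreover have "Y q = u" using u homeomorphism_apply1[OF Y, of u] by simp
    ultimately show ?thesis using v by force
  qed
  ultimately obtain d where d: "d > 0" "ball u d \<subseteq> (Y \<circ> Z) ` V'"
    using open_contains_ball by blast
  have "(Y \<circ> Z) ` V' \<subseteq> half_plane" using ZV' homeomorphism_image2[OF Y] by auto
  \<comment> \<open>A point just below \<open>u\<close> lies in the ball, yet the image of the
    transition map stays in the half plane.\<close>
  moreover have "u + (0, - d/2) \<in> ball u d" using d by (simp add: dist_norm norm_Pair)
  ultimately have "snd (u + (0, - d/2)) \<ge> 0" using d by blast
  then show False using d u by simp
qed

text \<open>The profile lives on the whole line although only the parameters from \<open>a\<close>
  to \<open>c\<close> are used, since boundary charts must extend smoothly across the edge. Arc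
  length is not imposed; \<open>g' > 0\<close> lets the height recover the parameter.\<close>

locale profile =
  fixes f g f' g' :: "real \<Rightarrow> real" and a c :: real
  assumes smooth_f: "smooth_on f UNIV" and smooth_g: "smooth_on g UNIV"
    and deriv_f: "\<And>s. (f has_real_derivative f' s) (at s)"
    and deriv_g: "\<And>s. (g has_real_derivative g' s) (at s)"
    and f_pos: "\<And>s. f s > 0" and g'_pos: "\<And>s. g' s > 0" and a_less: "a < c"
begin

definition band :: "(real^3) set" where
  "band = rot f g ` (UNIV \<times> {a..c})"

lemma g_strict_mono: "strict_mono g"
  using DERIV_pos_imp_increasing deriv_g g'_pos by (metis strict_monoI)

lemma g_eq_iff [simp]: "g s = g t \<longleftrightarrow> s = t"
  using strict_mono_eq[OF g_strict_mono] .

lemma inj_g: "inj g"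
  by (simp add: inj_def)

lemma continuous_g: "continuous_on A g"
  using deriv_g by (intro continuous_at_imp_continuous_on ballI DERIV_isCont)

text \<open>The affine change of parameter serves the boundary charts, which move an end point to 0
  and, with \<open>e = -1\<close>, turn the surface to the upper side of the edge.\<close>

lemma has_derivative_chart:
  "(rot (\<lambda>t. f (p + e * t)) (\<lambda>t. g (p + e * t)) has_derivative
     (\<lambda>v. fst v *\<^sub>R vector [- f s * sin \<theta>, f s * cos \<theta>, 0]
      + (snd v * e) *\<^sub>R vector [f' s * cos \<theta>, f' s * sin \<theta>, g' s])) (at (\<theta>, t))"
  if s: "s = p + e * t"
proof -
  have d: "((\<lambda>t. h (p + e * t)) has_real_derivative e * h' s) (at t)"
    if "\<And>s. (h has_real_derivative h' s) (at s)" for h h'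
  proof -
    have "((\<lambda>t. p + e * t) has_real_derivative e) (at t)"
      by (auto intro!: derivative_eq_intros)
    from DERIV_chain2[OF that this] show ?thesis by (simp add: s mult.commute)
  qed
  show ?thesis
    using has_derivative_rot[OF d[OF deriv_f] d[OF deriv_g], of \<theta>] s
    by (rule_tac has_derivative_eq_rhs) (auto simp: vec3_eq_iff fun_eq_iff algebra_simps)
qed

text \<open>Treats interior and boundary charts at once: assumption \<open>H\<close> says that
  inside the parameter window the model set cuts out exactly the parameters of the band.\<close>

lemma local_chart_band:
  fixes \<theta>0 p e :: real and W :: "real set"
  assumes e: "e \<noteq> 0" and W: "open W"
    and H: "\<And>\<theta> t. t \<in> W \<Longrightarrow> (\<theta>, t) \<in> H \<longleftrightarrow> p + e * t \<in> {a..c}"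
  shows "local_chart band H ({\<theta>0 - pi/2<..<\<theta>0 + pi/2} \<times> W)
    (rot (\<lambda>t. f (p + e * t)) (\<lambda>t. g (p + e * t)))"
proof -
  let ?U = "{\<theta>0 - pi/2<..<\<theta>0 + pi/2} \<times> W" and ?X = "rot (\<lambda>t. f (p + e * t)) (\<lambda>t. g (p + e * t))"
  \<comment> \<open>Horizontal coordinates turned by the angle \<theta>0. On the chart
    \<open>?x\<close> is positive, so the angle is recovered from \<open>?y / ?x\<close>.\<close>
  let ?x = "\<lambda>q :: real^3. q $ 1 * cos \<theta>0 + q $ 2 * sin \<theta>0"
  let ?y = "\<lambda>q :: real^3. q $ 2 * cos \<theta>0 - q $ 1 * sin \<theta>0"
  let ?G = "g ` (\<lambda>t. p + e * t) ` W"
  obtain ginv where ginv: "homeomorphism UNIV (range g) g ginv"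
    using invariance_of_domain_homeomorphism[OF open_UNIV continuous_g _ inj_g] by auto
  have ginv_g: "ginv (g s) = s" for s
    using ginv by (simp add: homeomorphism_def)
  \<comment> \<open>The explicit inverse of the chart: the arctangent returns the angle and the
    inverse of \<open>g\<close> the parameter.\<close>
  define Y where "Y q = (\<theta>0 + arctan (?y q / ?x q), (ginv (q $ 3) - p) / e)" for q :: "real^3"
  have x_eq: "?x (?X (\<theta>, t)) = f (p + e * t) * cos (\<theta> - \<theta>0)"
    and y_eq: "?y (?X (\<theta>, t)) = f (p + e * t) * sin (\<theta> - \<theta>0)" for \<theta> t
    by (simp_all add: cos_diff sin_diff algebra_simps)
  have x_pos: "?x (?X u) > 0" if "u \<in> ?U" for u
  proof -
    obtain \<theta> t where u: "u = (\<theta>, t)" by force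
    then show ?thesis using that x_eq[of \<theta> t] f_pos[of "p + e * t"] cos_gt_zero_pi[of "\<theta> - \<theta>0"] by simp
  qed
  have Y_X: "Y (?X u) = u" if "u \<in> ?U" for u
  proof -
    obtain \<theta> t where u: "u = (\<theta>, t)" by force
    have "?y (?X u) / ?x (?X u) = tan (\<theta> - \<theta>0)"
      using f_pos[of "p + e * t"] unfolding u x_eq y_eq by (simp add: tan_def)
    moreover have "arctan (tan (\<theta> - \<theta>0)) = \<theta> - \<theta>0"
      using that u by (intro arctan_tan) auto
    ultimately show ?thesis using e by (simp add: Y_def u ginv_g)
  qed
  \<comment> \<open>The chart image is cut out of the band by two conditions on the point in space,
    a half space and a range of heights, both of them open.\<close>
  have image_eq: "?X ` (?U \<inter> H) = band \<inter> ({q. ?x q > 0} \<inter> (\<lambda>q. q $ 3) -` ?G)"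
  proof (intro equalityI subsetI)
    fix q assume "q \<in> ?X ` (?U \<inter> H)"
    then obtain u where u: "u \<in> ?U" "u \<in> H" "q = ?X u" by auto
    obtain \<theta> t where ut: "u = (\<theta>, t)" by force
    have "q = rot f g (\<theta>, p + e * t)" using u ut by (simp add: rot_def)
    then have "q \<in> band" using u ut H unfolding band_def by auto
    moreover have "?x q > 0" using x_pos u by auto
    moreover have "q $ 3 \<in> ?G" using u ut by auto
    ultimately show "q \<in> band \<inter> ({q. ?x q > 0} \<inter> (\<lambda>q. q $ 3) -` ?G)" by simp
  next
    fix q assume q: "q \<in> band \<inter> ({q. ?x q > 0} \<inter> (\<lambda>q. q $ 3) -` ?G)"
    then obtain \<theta> s where s: "q = rot f g (\<theta>, s)" "s \<in> {a..c}" unfolding band_def by auto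
    obtain t where t: "t \<in> W" "s = p + e * t" using q s by auto
    have "?x q = f s * cos (\<theta> - \<theta>0)" by (simp add: s cos_diff algebra_simps)
    then have "cos (\<theta> - \<theta>0) > 0" using q f_pos[of s] by (auto simp: zero_less_mult_iff)
    then obtain \<eta> where \<eta>: "\<eta> \<in> {\<theta>0 - pi/2<..<\<theta>0 + pi/2}" "cos \<eta> = cos \<theta>" "sin \<eta> = sin \<theta>"
      by (rule obtain_angle_near)
    have "q = ?X (\<eta>, t)" by (simp add: s t \<eta> rot_def)
    moreover have "(\<eta>, t) \<in> ?U \<inter> H" using \<eta> t H s by auto
    ultimately show "q \<in> ?X ` (?U \<inter> H)" by blast
  qed
  have aff: "open ((\<lambda>t. p + e * t) ` W)"
    by (rule invariance_of_domain[OF _ W]) (use e in \<open>auto intro!: continuous_intros inj_onI\<close>)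
  have "open ?G"
    by (rule invariance_of_domain[OF continuous_g aff inj_on_subset[OF inj_g]]) simp
  then have "open ((\<lambda>q :: real^3. q $ 3) -` ?G)"
    by (rule open_vimage) (intro continuous_intros)
  moreover have "open {q. ?x q > 0}"
    by (intro open_Collect_less continuous_intros)
  ultimately have "open ({q. ?x q > 0} \<inter> (\<lambda>q. q $ 3) -` ?G)"
    by blast
  then have opn: "openin (top_of_set band) (?X ` (?U \<inter> H))"
    unfolding image_eq by (rule openin_open_Int)
  have aff_smooth: "smooth_on (\<lambda>t. h (p + e * t)) UNIV" if "smooth_on h UNIV" for h :: "real \<Rightarrow> real"
    by (rule smooth_on_compose[OF open_UNIV open_UNIV that])
      (auto intro!: smooth_on_add smooth_on_mult smooth_on_const smooth_on_ident)
  have sm: "smooth_on ?X UNIV"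
    by (intro smooth_on_rot aff_smooth smooth_f smooth_g)
  have "inj (frechet_derivative ?X (at u))" for u
  proof -
    obtain \<theta> t where u: "u = (\<theta>, t)" by force
    let ?s = "p + e * t"
    note D = has_derivative_chart[OF refl, of p e t \<theta>]
    note fr = frechet_derivative_at[OF D, symmetric]
    \<comment> \<open>The angular tangent vector is horizontal, so the third component forces
      \<open>snd v = 0\<close>; then \<open>fst v = 0\<close>, since sine and cosine do not vanish
      together.\<close>
    have "v = 0" if "frechet_derivative ?X (at u) v = 0" for v
    proof -
      have v: "snd v * e * g' ?s = 0" "fst v * f ?s * cos \<theta> = 0 " "fst v * f ?s * sin \<theta> = 0 "
        using that e g'_pos[of ?s] unfolding u fr by (auto simp: vec3_eq_iff)
      then have "snd v = 0" using e g'_pos[of ?s] by auto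
      moreover have "fst v = 0" using v(2,3) f_pos[of ?s] sin_zero_abs_cos_one by force
      ultimately show ?thesis by (simp add: prod_eq_iff)
    qed
    then show ?thesis
      using linear_injective_0[OF has_derivative_linear[OF D]] unfolding u fr by blast
  qed
  moreover have "homeomorphism (?U \<inter> H) (?X ` (?U \<inter> H)) ?X Y"
  proof (rule homeomorphismI)
    show "continuous_on (?U \<inter> H) ?X"
      using smooth_on_imp_continuous_on[OF sm] continuous_on_subset by blast
    show "continuous_on (?X ` (?U \<inter> H)) Y"
      unfolding Y_def using e x_pos
      by (intro continuous_intros continuous_on_compose2[OF homeomorphism_cont2[OF ginv]])
        (force simp: rot_def)+
    show "Y ` ?X ` (?U \<inter> H) \<subseteq> ?U \<inter> H" using Y_X by force
    show "Y (?X u) = u" if "u \<in> ?U \<inter> H" for u using Y_X that by blast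
    show "?X (Y q) = q" if "q \<in> ?X ` (?U \<inter> H)" for q using Y_X that by force
  qed auto
  ultimately show ?thesis
    unfolding local_chart_def using W opn smooth_on_subset[OF sm]
    by (auto intro!: open_Times)
qed

end

section \<open>The band as a compact surface, its boundary and the free boundary condition\<close>

context profile
begin

text \<open>Restricts the angle to a period, which presents the band as a continuous image of a
  compact rectangle.\<close>

lemma band_eq: "band = rot f g ` ({0..2*pi} \<times> {a..c})"
proof -
  have "rot f g (\<theta>, s) \<in> rot f g ` ({0..2*pi} \<times> {a..c})" if "s \<in> {a..c}" for \<theta> s
  proof -
    obtain t where "0 \<le> t" "t < 2*pi" "cos \<theta> = cos t" "sin \<theta> = sin t"
      using sincos_total_2pi[of "cos \<theta>" "sin \<theta>"] by auto
    then have "rot f g (\<theta>, s) = rot f g (t, s)" "t \<in> {0..2*pi}" by (auto simp: rot_def)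
    then show ?thesis using that by blast
  qed
  then show ?thesis unfolding band_def by auto
qed

lemma continuous_rot: "continuous_on A (rot f g)"
  using smooth_on_imp_continuous_on[OF smooth_on_rot[OF smooth_f smooth_g]] continuous_on_subset by blast

lemma compact_band: "compact band"
  unfolding band_eq by (intro compact_continuous_image continuous_rot compact_Times compact_Icc)

lemma connected_band: "connected band"
  unfolding band_def
  by (intro connected_continuous_image continuous_rot connected_Times connected_UNIV connected_Icc)

lemma interior_chart_band:
  "local_chart band UNIV ({\<theta> - pi/2<..<\<theta> + pi/2} \<times> {a<..<c}) (rot f g)"
  using local_chart_band[of 1 "{a<..<c}" UNIV 0 \<theta>] by auto

text \<open>The parameter is reversed so that \<open>t \<ge> 0\<close> runs from \<open>c\<close>
  into the band; the bound \<open>t < c - a\<close> keeps the other boundary circle out of the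
  chart.\<close>

lemma upper_chart_band:
  "local_chart band half_plane ({\<theta> - pi/2<..<\<theta> + pi/2} \<times> {a - c<..<c - a})
    (rot (\<lambda>t. f (c + (-1) * t)) (\<lambda>t. g (c + (-1) * t)))"
  by (rule local_chart_band) (use a_less in auto)

lemma lower_chart_band:
  "local_chart band half_plane ({\<theta> - pi/2<..<\<theta> + pi/2} \<times> {a - c<..<c - a})
    (rot (\<lambda>t. f (a + 1 * t)) (\<lambda>t. g (a + 1 * t)))"
  by (rule local_chart_band) (use a_less in auto)

lemma surface_boundary_band: "surface_boundary band = rot f g ` (UNIV \<times> {a, c})"
proof (intro equalityI subsetI)
  fix q assume q: "q \<in> surface_boundary band"
  then have "q \<in> band"
    unfolding surface_boundary_def local_chart_def using openin_imp_subset by fastforce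
  then obtain \<theta> s where s: "q = rot f g (\<theta>, s)" "s \<in> {a..c}" unfolding band_def by auto
  \<comment> \<open>These parameters belong to an interior chart, which contains no boundary
    point.\<close>
  have "s \<notin> {a<..<c}"
    using surface_boundary_disjoint_interior_chart[OF interior_chart_band[of \<theta>]] q s by force
  then show "q \<in> rot f g ` (UNIV \<times> {a, c})" using s by force
next
  fix q assume "q \<in> rot f g ` (UNIV \<times> {a, c})"
  then obtain \<theta> where "q = rot f g (\<theta>, a) \<or> q = rot f g (\<theta>, c)" by auto
  then show "q \<in> surface_boundary band"
  proof
    assume q: "q = rot f g (\<theta>, a)"
    have "(\<theta>, 0) \<in> ({\<theta> - pi/2<..<\<theta> + pi/2} \<times> {a - c<..<c - a}) \<inter> edge"
      using a_less by auto
    moreover have "rot (\<lambda>t. f (a + 1 * t)) (\<lambda>t. g (a + 1 * t)) (\<theta>, 0) = q" by (simp add: q rot_def)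
    ultimately show ?thesis unfolding surface_boundary_def using lower_chart_band[of \<theta>] by blast
  next
    assume q: "q = rot f g (\<theta>, c)"
    have "(\<theta>, 0) \<in> ({\<theta> - pi/2<..<\<theta> + pi/2} \<times> {a - c<..<c - a}) \<inter> edge"
      using a_less by auto
    moreover have "rot (\<lambda>t. f (c + (-1) * t)) (\<lambda>t. g (c + (-1) * t)) (\<theta>, 0) = q" by (simp add: q rot_def)
    ultimately show ?thesis unfolding surface_boundary_def using upper_chart_band[of \<theta>] by blast
  qed
qed

text \<open>Gives the three charts a uniform shape, for use both in
  \<open>compact_surface_band\<close> and in the proof of minimality.\<close>

lemma band_chart_cases:
  assumes "q \<in> band"
  obtains H \<theta> t p e W where "H \<in> {UNIV, half_plane}" "e = 1 \<or> e = -1"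
    "local_chart band H ({\<theta> - pi/2<..<\<theta> + pi/2} \<times> W)
       (rot (\<lambda>t. f (p + e * t)) (\<lambda>t. g (p + e * t)))"
    "q \<in> rot (\<lambda>t. f (p + e * t)) (\<lambda>t. g (p + e * t)) ` (({\<theta> - pi/2<..<\<theta> + pi/2} \<times> W) \<inter> H)"
proof -
  obtain \<theta> s where s: "q = rot f g (\<theta>, s)" "s \<in> {a..c}" using assms unfolding band_def by auto
  consider "s \<in> {a<..<c}" | "s = a" | "s = c" using s by force
  then show thesis
  proof cases
    case 1
    show ?thesis
    proof (rule that[of UNIV 1 \<theta> "{a<..<c}" 0])
      show "q \<in> rot (\<lambda>t. f (0 + 1 * t)) (\<lambda>t. g (0 + 1 * t)) ` (({\<theta> - pi/2<..<\<theta> + pi/2} \<times> {a<..<c}) \<inter> UNIV)"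
        by (rule image_eqI[of _ _ "(\<theta>, s)"]) (use 1 s in auto)
    qed (use interior_chart_band[of \<theta>] in auto)
  next
    case 2
    show ?thesis
    proof (rule that[OF _ _ lower_chart_band[of \<theta>]])
      show "q \<in> rot (\<lambda>t. f (a + 1 * t)) (\<lambda>t. g (a + 1 * t)) ` (({\<theta> - pi/2<..<\<theta> + pi/2} \<times> {a - c<..<c - a}) \<inter> half_plane)"
        by (rule image_eqI[of _ _ "(\<theta>, 0)"]) (use 2 s a_less in \<open>auto simp: rot_def\<close>)
    qed auto
  next
    case 3
    show ?thesis
    proof (rule that[OF _ _ upper_chart_band[of \<theta>]])
      show "q \<in> rot (\<lambda>t. f (c + (-1) * t)) (\<lambda>t. g (c + (-1) * t)) ` (({\<theta> - pi/2<..<\<theta> + pi/2} \<times> {a - c<..<c - a}) \<inter> half_plane)"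
        by (rule image_eqI[of _ _ "(\<theta>, 0)"]) (use 3 s a_less in \<open>auto simp: rot_def\<close>)
    qed auto
  qed
qed

lemma compact_surface_band: "compact_surface band"
  unfolding compact_surface_def
proof (intro conjI ballI compact_band connected_band)
  show "band \<noteq> {}" using a_less unfolding band_def by auto
  show "\<exists>H\<in>{UNIV, half_plane}. \<exists>U X. local_chart band H U X \<and> q \<in> X ` (U \<inter> H)" if "q \<in> band" for q
    using band_chart_cases[OF that] by metis
qed

lemma norm_rot: "(norm (rot f g (\<theta>, s)))\<^sup>2 = (f s)\<^sup>2 + (g s)\<^sup>2"
proof -
  have "(norm (rot f g (\<theta>, s)))\<^sup>2 = (f s)\<^sup>2 * ((cos \<theta>)\<^sup>2 + (sin \<theta>)\<^sup>2) + (g s)\<^sup>2"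
    unfolding power2_norm_eq_inner inner_vec3 rot_nth by algebra
  then show ?thesis by simp
qed

lemma exterior_unit_conormal_band:
  assumes chart: "local_chart band half_plane ({\<theta> - pi/2<..<\<theta> + pi/2} \<times> {a - c<..<c - a})
      (rot (\<lambda>t. f (s + e * t)) (\<lambda>t. g (s + e * t)))"
    and k: "k > 0" "e \<noteq> 0" "f s = - k * e * f' s" "g s = - k * e * g' s" and unit: "(f s)\<^sup>2 + (g s)\<^sup>2 = 1"
  shows "exterior_unit_conormal band (rot f g (\<theta>, s)) (rot f g (\<theta>, s))"
proof -
  let ?X = "rot (\<lambda>t. f (s + e * t)) (\<lambda>t. g (s + e * t))"
  note D = has_derivative_chart[of s s e 0 \<theta>, simplified]
  note fr = frechet_derivative_at[OF D, symmetric]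
  have "norm (rot f g (\<theta>, s)) = 1"
    using norm_rot[of \<theta> s] unit by (simp add: power2_eq_1_iff) (smt (verit) norm_ge_zero)
  \<comment> \<open>The coordinate vector \<open>(0, - k)\<close> points out of the half plane. Its
    image is \<open>- k * e\<close> times the meridian tangent, which is the position vector by
    hypothesis.\<close>
  moreover have "rot f g (\<theta>, s) = frechet_derivative ?X (at (\<theta>, 0)) (0, - k)"
    unfolding fr by (simp add: vec3_eq_iff k(3,4))
  moreover have "rot f g (\<theta>, s) \<bullet> frechet_derivative ?X (at (\<theta>, 0)) (1, 0) = 0"
    unfolding fr by (simp add: inner_vec3)
  moreover have "(\<theta>, 0) \<in> ({\<theta> - pi/2<..<\<theta> + pi/2} \<times> {a - c<..<c - a}) \<inter> edge"
    using a_less by auto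
  moreover have "?X (\<theta>, 0) = rot f g (\<theta>, s)" by (simp add: rot_def)
  moreover have "snd (0::real, - k) < 0" using k by simp
  ultimately show ?thesis
    unfolding exterior_unit_conormal_def using chart by blast
qed

text \<open>At \<open>a\<close> the exterior direction is that of decreasing parameter, hence the
  minus signs there. As the end points are unit vectors, \<open>k\<close> and \<open>l\<close> are
  the reciprocals of the speed.\<close>

lemma meets_unit_sphere_orthogonally_band:
  assumes inner: "\<And>s. s \<in> {a<..<c} \<Longrightarrow> (f s)\<^sup>2 + (g s)\<^sup>2 < 1"
    and a: "(f a)\<^sup>2 + (g a)\<^sup>2 = 1" "k > 0" "f a = - k * f' a" "g a = - k * g' a"
    and c: "(f c)\<^sup>2 + (g c)\<^sup>2 = 1" "l > 0" "f c = l * f' c" "g c = l * g' c"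
  shows "meets_unit_sphere_orthogonally band"
  unfolding meets_unit_sphere_orthogonally_def
proof (intro conjI ballI compact_surface_band)
  show "surface_boundary band \<noteq> {}" unfolding surface_boundary_band by auto
  show "surface_interior band \<subseteq> ball 0 1"
  proof
    fix q assume "q \<in> surface_interior band"
    then obtain \<theta> s where q: "q = rot f g (\<theta>, s)" and s: "s \<in> {a<..<c}"
      unfolding surface_interior_def surface_boundary_band unfolding band_def by force
    have "(norm q)\<^sup>2 < 1\<^sup>2" unfolding q norm_rot using inner[OF s] by simp
    then have "norm q < 1" by (rule power2_less_imp_less) simp
    then show "q \<in> ball 0 1" by simp
  qed
  show "surface_boundary band \<subseteq> sphere 0 1"
  proof
    fix q assume "q \<in> surface_boundary band"
    then have "(norm q)\<^sup>2 = 1\<^sup>2"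
      unfolding surface_boundary_band using a c by (auto simp: norm_rot)
    then have "norm q = 1" by (rule power2_eq_imp_eq) simp_all
    then show "q \<in> sphere 0 1" by simp
  qed
  fix q assume "q \<in> surface_boundary band"
  then consider \<theta> where "q = rot f g (\<theta>, a)" | \<theta> where "q = rot f g (\<theta>, c)"
    unfolding surface_boundary_band by auto
  then show "exterior_unit_conormal band q q"
  proof cases
    case 1
    show ?thesis unfolding 1
      by (rule exterior_unit_conormal_band[OF lower_chart_band, of k]) (use a in auto)
  next
    case 2
    show ?thesis unfolding 2
      by (rule exterior_unit_conormal_band[OF upper_chart_band, of l]) (use c in auto)
  qed
qed

end

section \<open>Vanishing mean curvature of rotational surfaces\<close>

lemma mean_curvature_rot_eq_0:
  assumes f: "\<And>s. (f has_real_derivative f' s) (at s)" and f': "\<And>s. (f' has_real_derivative f'' s) (at s)"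
    and g: "\<And>s. (g has_real_derivative g' s) (at s)" and g': "\<And>s. (g' has_real_derivative g'' s) (at s)"
    and eq: "f s * (f'' s * g' s - g'' s * f' s) = g' s * ((f' s)\<^sup>2 + (g' s)\<^sup>2)"
  shows "mean_curvature (rot f g) (\<theta>, s) = 0"
proof -
  let ?X = "rot f g" and ?u = "(\<theta>, s)"
  have fr: "frechet_derivative ?X (at u) = (\<lambda>v. fst v *\<^sub>R vector [- f (snd u) * sin (fst u), f (snd u) * cos (fst u), 0]
      + snd v *\<^sub>R vector [f' (snd u) * cos (fst u), f' (snd u) * sin (fst u), g' (snd u)])" for u
    using frechet_derivative_at[OF has_derivative_rot[OF f g], symmetric] by (cases u) simp
  have X1: "partial1 ?X = (\<lambda>u. vector [f (snd u) * - sin (fst u), f (snd u) * cos (fst u), 0])"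
    and X2: "partial2 ?X = (\<lambda>u. vector [f' (snd u) * cos (fst u), f' (snd u) * sin (fst u), g' (snd u)])"
    by (auto simp: partial1_def partial2_def fr fun_eq_iff)
  have "((\<lambda>\<theta>. - sin \<theta>) has_real_derivative - cos \<theta>) (at \<theta>)"
    by (auto intro!: derivative_eq_intros)
  from frechet_derivative_at[OF has_derivative_separated[OF f DERIV_const this DERIV_cos], symmetric]
  have X11: "partial1 (partial1 ?X) ?u = vector [- f s * cos \<theta>, - f s * sin \<theta>, 0]"
    unfolding X1 unfolding partial1_def by simp
  from frechet_derivative_at[OF has_derivative_separated[OF f' g' DERIV_cos DERIV_sin], symmetric]
  have X22: "partial2 (partial2 ?X) ?u = vector [f'' s * cos \<theta>, f'' s * sin \<theta>, g'' s]"
    unfolding X2 unfolding partial2_def by simp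
  have sc: "(cos \<theta>)\<^sup>2 + (sin \<theta>)\<^sup>2 = 1" by simp
  \<comment> \<open>The coordinates are orthogonal, so the mean curvature reduces to the terms of
    the parallels and of the meridians; \<open>eq\<close> says that these cancel.\<close>
  have E: "partial1 ?X ?u \<bullet> partial1 ?X ?u = (f s)\<^sup>2"
    unfolding X1 inner_vec3 by (simp, use sc in algebra)
  have F: "partial1 ?X ?u \<bullet> partial2 ?X ?u = 0"
    unfolding X1 X2 inner_vec3 by simp
  have G: "partial2 ?X ?u \<bullet> partial2 ?X ?u = (f' s)\<^sup>2 + (g' s)\<^sup>2"
    unfolding X2 inner_vec3 by (simp, use sc in algebra)
  \<comment> \<open>The normal before normalisation; the factor \<open>inverse (norm N)\<close> is
    later pulled out of the whole numerator.\<close>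
  define N where "N = cross3 (partial1 ?X ?u) (partial2 ?X ?u)"
  have N: "N = f s *\<^sub>R vector [g' s * cos \<theta>, g' s * sin \<theta>, - f' s]"
    unfolding N_def X1 X2 cross3_def vec3_eq_iff by (simp, use sc in algebra)
  have L: "partial1 (partial1 ?X) ?u \<bullet> N = - (f s)\<^sup>2 * g' s"
    unfolding X11 N inner_vec3 by (simp, use sc in algebra)
  have P: "partial2 (partial2 ?X) ?u \<bullet> N = f s * (f'' s * g' s - g'' s * f' s)"
    unfolding X22 N inner_vec3 by (simp, use sc in algebra)
  have un: "unit_normal ?X ?u = inverse (norm N) *\<^sub>R N"
    by (simp add: unit_normal_def N_def sgn_div_norm)
  have "(- (f s)\<^sup>2 * g' s) * ((f' s)\<^sup>2 + (g' s)\<^sup>2) + (f s * (f'' s * g' s - g'' s * f' s)) * (f s)\<^sup>2 = 0"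
    unfolding eq by (simp add: algebra_simps)
  then have "inverse (norm N) * ((- (f s)\<^sup>2 * g' s) * ((f' s)\<^sup>2 + (g' s)\<^sup>2)
      + (f s * (f'' s * g' s - g'' s * f' s)) * (f s)\<^sup>2) = 0" by simp
  then show ?thesis
    unfolding mean_curvature_def Let_def un inner_scaleR_right L P E F G
    by (simp add: algebra_simps)
qed

lemma (in profile) minimal_surface_band:
  assumes f': "\<And>s. (f' has_real_derivative f'' s) (at s)" and g': "\<And>s. (g' has_real_derivative g'' s) (at s)"
    and eq: "\<And>s. f s * (f'' s * g' s - g'' s * f' s) = g' s * ((f' s)\<^sup>2 + (g' s)\<^sup>2)"
  shows "minimal_surface band"
  unfolding minimal_surface_def
proof
  fix q assume "q \<in> band"
  then obtain H \<theta> p e W where H: "H \<in> {UNIV, half_plane}" and e: "e = 1 \<or> e = -1"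
    and ch: "local_chart band H ({\<theta> - pi/2<..<\<theta> + pi/2} \<times> W)
       (rot (\<lambda>t. f (p + e * t)) (\<lambda>t. g (p + e * t)))"
    and q: "q \<in> rot (\<lambda>t. f (p + e * t)) (\<lambda>t. g (p + e * t)) ` (({\<theta> - pi/2<..<\<theta> + pi/2} \<times> W) \<inter> H)"
    by (rule band_chart_cases)
  have d: "((\<lambda>t. k * h (p + e * t)) has_real_derivative k * e * h' (p + e * t)) (at t)"
    if "\<And>s. (h has_real_derivative h' s) (at s)" for h h' k t
    by (rule derivative_eq_intros DERIV_chain2[OF that] refl)+ simp
  have e2: "e * e = 1" using e by auto
  have "mean_curvature (rot (\<lambda>t. f (p + e * t)) (\<lambda>t. g (p + e * t))) (\<eta>, t) = 0" for \<eta> t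
  proof (rule mean_curvature_rot_eq_0)
    show "((\<lambda>t. f (p + e * t)) has_real_derivative e * f' (p + e * t)) (at t)"
      "((\<lambda>t. g (p + e * t)) has_real_derivative e * g' (p + e * t)) (at t)" for t
      using d[OF deriv_f, of 1] d[OF deriv_g, of 1] by simp_all
    show "((\<lambda>t. e * f' (p + e * t)) has_real_derivative f'' (p + e * t)) (at t)"
      "((\<lambda>t. e * g' (p + e * t)) has_real_derivative g'' (p + e * t)) (at t)" for t
      using d[OF f', of e] d[OF g', of e] by (simp_all add: e2)
    \<comment> \<open>Reversing the parameter multiplies first derivatives by \<open>e\<close> and
      second ones by \<open>e * e = 1\<close>, so both sides of the equation acquire the same factor
      \<open>e\<close>.\<close>
    show "f (p + e * t) * (f'' (p + e * t) * (e * g' (p + e * t)) - g'' (p + e * t) * (e * f' (p + e * t))) =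
      e * g' (p + e * t) * ((e * f' (p + e * t))\<^sup>2 + (e * g' (p + e * t))\<^sup>2)"
      using eq[of "p + e * t"] e2 by algebra
  qed
  then have "\<forall>u. mean_curvature (rot (\<lambda>t. f (p + e * t)) (\<lambda>t. g (p + e * t))) u = 0" by auto
  then show "\<exists>H\<in>{UNIV, half_plane}. \<exists>U X. local_chart band H U X \<and> q \<in> X ` (U \<inter> H) \<and>
        (\<forall>u\<in>U \<inter> H. mean_curvature X u = 0)"
    using H ch q by blast
qed

section \<open>The profile curves\<close>

definition slope :: "real \<Rightarrow> real \<Rightarrow> real" where
  "slope b x = sqrt (1 + (1 - b) * x\<^sup>2) / sqrt (1 + x\<^sup>2)"

lemma one_plus_square_pos [simp]: "0 < 1 + (x::real)\<^sup>2"
  by (simp add: add_pos_nonneg)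

lemma radicand_pos: "b \<le> 1 \<Longrightarrow> 0 < 1 + (1 - b) * (x::real)\<^sup>2"
  by (simp add: add_pos_nonneg)

lemma slope_pos: "b \<le> 1 \<Longrightarrow> 0 < slope b x"
  by (simp add: slope_def radicand_pos)

text \<open>The radius \<open>sqrt b * sqrt (1 + x\<^sup>2)\<close> has derivative
  \<open>sqrt b * x / sqrt (1 + x\<^sup>2)\<close>, so this identity says that the unscaled profile
  has unit speed.\<close>

lemma slope_square: "b \<le> 1 \<Longrightarrow> (slope b x)\<^sup>2 = 1 - b * (x\<^sup>2 / (1 + x\<^sup>2))"
  using radicand_pos[of b x] less_imp_neq[OF one_plus_square_pos[of x], symmetric]
  by (simp add: slope_def power_divide less_imp_le field_simps)

lemma slope_le_1:
  assumes "0 \<le> b" "b \<le> 1"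
  shows "slope b x \<le> 1"
  by (rule power2_le_imp_le) (use slope_square[of b x] assms in auto)

lemma slope_minus [simp]: "slope b (- x) = slope b x"
  by (simp add: slope_def)

lemma slope_antimono:
  assumes "0 \<le> b" "b \<le> 1" "0 \<le> x" "x \<le> y"
  shows "slope b y \<le> slope b x"
proof (rule power2_le_imp_le)
  have "x\<^sup>2 / (1 + x\<^sup>2) \<le> y\<^sup>2 / (1 + y\<^sup>2)"
    using assms power_mono[of x y 2] by (simp add: divide_simps algebra_simps)
  then show "(slope b y)\<^sup>2 \<le> (slope b x)\<^sup>2"
    using assms mult_left_mono by (fastforce simp: slope_square simp del: times_divide_eq_right)
qed (use slope_pos assms in \<open>auto intro: less_imp_le\<close>)

text \<open>For positive p and q, (p - q)^2 is at most |p^2 - q^2|, and the squares differ by at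
  most |b - b'|. The bound is uniform in \<open>x\<close>.\<close>

lemma slope_diff_le:
  assumes "b \<le> 1" "b' \<le> 1"
  shows "\<bar>slope b x - slope b' x\<bar> \<le> sqrt \<bar>b - b'\<bar>"
proof (rule real_le_rsqrt)
  let ?p = "slope b x" and ?q = "slope b' x"
  have pq: "?p > 0" "?q > 0" using slope_pos assms by auto
  have "\<bar>?p - ?q\<bar>\<^sup>2 \<le> \<bar>?p - ?q\<bar> * (?p + ?q)"
    unfolding power2_eq_square using pq by (intro mult_left_mono) auto
  also have "\<dots> = \<bar>(?p - ?q) * (?p + ?q)\<bar>"
    using pq by (simp add: abs_mult)
  also have "(?p - ?q) * (?p + ?q) = (b' - b) * (x\<^sup>2 / (1 + x\<^sup>2))"
    using slope_square[OF assms(1), of x] slope_square[OF assms(2), of x] by algebra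
  also have "\<bar>\<dots>\<bar> \<le> \<bar>b - b'\<bar> * 1"
    unfolding abs_mult
    by (intro mult_mono) (auto simp: abs_minus_commute abs_of_nonneg[OF divide_nonneg_pos])
  finally show "\<bar>?p - ?q\<bar>\<^sup>2 \<le> \<bar>b - b'\<bar>" by simp
qed

lemma continuous_slope: "continuous_on UNIV (slope b)"
  unfolding slope_def[abs_def]
  by (intro continuous_intros) (auto simp: add_nonneg_eq_0_iff)

text \<open>Choosing the antiderivative that vanishes at 0 treats both signs of \<open>x\<close> at
  once.\<close>

definition height :: "real \<Rightarrow> real \<Rightarrow> real" where
  "height b = (SOME F. F 0 = 0 \<and> (\<forall>x. (F has_real_derivative slope b x) (at x)))"

lemma height_0 [simp]: "height b 0 = 0"
  and DERIV_height: "(height b has_real_derivative slope b x) (at x)"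
proof -
  obtain F where F: "\<And>x. (F has_vector_derivative slope b x) (at x)"
    using einterval_antiderivative[of "-\<infinity>" \<infinity> "slope b"] continuous_slope[of b]
    by (auto simp: continuous_on_eq_continuous_at)
  have "((\<lambda>x. F x - F 0) has_real_derivative slope b x) (at x)" for x
    using F[of x] by (auto intro!: derivative_eq_intros simp: has_real_derivative_iff_has_vector_derivative)
  then have "\<exists>F. F 0 = 0 \<and> (\<forall>x. (F has_real_derivative slope b x) (at x))"
    by (intro exI[of _ "\<lambda>x. F x - F 0"]) simp
  from someI_ex[OF this, folded height_def]
  show "height b 0 = 0" "(height b has_real_derivative slope b x) (at x)" by auto
qed

text \<open>The sum of the two heights has derivative 0, because \<open>slope b\<close> is even, and
  vanishes at 0.\<close>

lemma height_minus [simp]: "height b (- x) = - height b x"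
proof -
  have "\<forall>x. ((\<lambda>x. height b x + height b (- x)) has_real_derivative 0) (at x)"
  proof
    fix x
    have "((\<lambda>x. height b (- x)) has_real_derivative slope b (- x) * (- 1)) (at x)"
      by (rule DERIV_chain2[OF DERIV_height]) (auto intro!: derivative_eq_intros)
    from DERIV_add[OF DERIV_height[of b x] this]
    show "((\<lambda>x. height b x + height b (- x)) has_real_derivative 0) (at x)" by simp
  qed
  from DERIV_isconst_all[OF this, of x 0] show ?thesis by simp
qed

lemma height_strict_mono: "b \<le> 1 \<Longrightarrow> x < y \<Longrightarrow> height b x < height b y"
  using DERIV_pos_imp_increasing[of x y "height b"] DERIV_height slope_pos by blast

lemma height_lipschitz:
  assumes "0 \<le> b" "b \<le> 1"
  shows "\<bar>height b x - height b y\<bar> \<le> \<bar>x - y\<bar>"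
proof -
  have "norm (height b x - height b y) \<le> 1 * norm (x - y)"
    by (rule field_differentiable_bound[of UNIV])
      (use DERIV_height slope_pos[of b] slope_le_1[of b] assms in \<open>auto simp: abs_of_pos\<close>)
  then show ?thesis by simp
qed

lemma abs_height_le: "0 \<le> b \<Longrightarrow> b \<le> 1 \<Longrightarrow> \<bar>height b x\<bar> \<le> \<bar>x\<bar>"
  using height_lipschitz[of b x 0] by simp

text \<open>The mean value inequality for the difference of two primitives turns
  \<open>slope_diff_le\<close> into continuity in the parameter.\<close>

lemma height_diff_le:
  assumes "b \<le> 1" "b' \<le> 1"
  shows "\<bar>height b x - height b' x\<bar> \<le> sqrt \<bar>b - b'\<bar> * \<bar>x\<bar>"
proof -
  have "norm ((height b x - height b' x) - (height b 0 - height b' 0)) \<le> sqrt \<bar>b - b'\<bar> * norm (x - 0)"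
    by (rule field_differentiable_bound[of UNIV "\<lambda>x. height b x - height b' x" "\<lambda>x. slope b x - slope b' x"])
      (auto intro!: DERIV_diff DERIV_height slope_diff_le assms)
  then show ?thesis by simp
qed

text \<open>The height at which the tangent line at \<open>x\<close> of the profile curve
  \<open>(sqrt b * sqrt (1 + x\<^sup>2), height b x)\<close> meets the axis; the free boundary condition says that this
  height is \<open>0\<close>.\<close>

definition gap :: "real \<Rightarrow> real \<Rightarrow> real" where
  "gap b x = height b x - sqrt (1 + (1 - b) * x\<^sup>2) * sqrt (1 + x\<^sup>2) / x"

section \<open>Existence, uniqueness and continuous dependence of the zero of
  \<open>gap\<close>\<close>

lemma DERIV_sqrt_radicand:
  assumes "b \<le> 1"
  shows "((\<lambda>x. sqrt (1 + (1 - b) * x\<^sup>2)) has_real_derivative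
    (1 - b) * x / sqrt (1 + (1 - b) * x\<^sup>2)) (at x)"
  using radicand_pos[OF assms, of x] by (auto intro!: derivative_eq_intros simp: field_simps)

lemma DERIV_gap:
  assumes "b \<le> 1" "x > 0"
  shows "(gap b has_real_derivative sqrt (1 + x\<^sup>2) / sqrt (1 + (1 - b) * x\<^sup>2) / x\<^sup>2) (at x)"
proof -
  let ?A = "sqrt (1 + (1 - b) * x\<^sup>2)" and ?w = "sqrt (1 + x\<^sup>2)"
  have pos: "?A > 0" "?w > 0" using radicand_pos[OF assms(1), of x] by auto
  have dA: "((\<lambda>x. sqrt (1 + (1 - b) * x\<^sup>2)) has_real_derivative (1 - b) * x / ?A) (at x)"
    by (rule DERIV_sqrt_radicand[OF assms(1)])
  have dw: "((\<lambda>x. sqrt (1 + x\<^sup>2)) has_real_derivative x / ?w) (at x)"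
    using DERIV_sqrt_radicand[of 0 x] by simp
  have A2: "?A\<^sup>2 = 1 + (1 - b) * x\<^sup>2" and w2: "?w\<^sup>2 = 1 + x\<^sup>2"
    using radicand_pos[OF assms(1), of x] by (auto simp: less_imp_le)
  have "(gap b has_real_derivative slope b x -
    (((1 - b) * x / ?A * ?w + x / ?w * ?A) * x - ?A * ?w * 1) / (x * x)) (at x)"
    unfolding gap_def[abs_def]
    by (rule DERIV_diff[OF DERIV_height DERIV_divide[OF DERIV_mult[OF dA dw] DERIV_ident]]) (use assms in auto)
  moreover have "slope b x - (((1 - b) * x / ?A * ?w + x / ?w * ?A) * x - ?A * ?w * 1) / (x * x)
     = ?w / ?A / x\<^sup>2"
  proof -
    \<comment> \<open>The claimed equality of derivatives, cleared of the denominators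
      \<open>?A\<close>, \<open>?w\<close> and the square of \<open>x\<close>.\<close>
    have eq: "?A\<^sup>2 * x\<^sup>2 - (((1 - b) * x * ?w\<^sup>2 + x * ?A\<^sup>2) * x - ?A\<^sup>2 * ?w\<^sup>2) = ?w\<^sup>2"
      unfolding A2 w2 by (simp add: algebra_simps power2_eq_square)
    show ?thesis
      using pos assms(2) eq unfolding slope_def
      by (simp add: divide_simps) (simp add: algebra_simps power2_eq_square)
  qed
  ultimately show ?thesis by simp
qed

lemma gap_strict_mono:
  assumes "b \<le> 1" "0 < x" "x < y"
  shows "gap b x < gap b y"
proof (rule DERIV_pos_imp_increasing[OF assms(3)])
  fix z assume "x \<le> z" "z \<le> y"
  then have "z > 0" using assms by linarith
  then show "\<exists>d. (gap b has_real_derivative d) (at z) \<and> 0 < d"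
    using DERIV_gap[OF assms(1) \<open>z > 0\<close>] radicand_pos[OF assms(1), of z] \<open>z > 0\<close>
    by (intro exI[of _ "sqrt (1 + z\<^sup>2) / sqrt (1 + (1 - b) * z\<^sup>2) / z\<^sup>2"] conjI) simp_all
qed

text \<open>At 1 the height is at most 1, while the subtracted term is at least
  \<open>sqrt 2\<close>.\<close>

lemma gap_1_neg:
  assumes "0 \<le> b" "b \<le> 1"
  shows "gap b 1 < 0"
proof -
  have "1 * sqrt 2 \<le> sqrt (1 + (1 - b)) * sqrt 2" using assms by (intro mult_right_mono) auto
  moreover have "height b 1 \<le> 1" using abs_height_le[OF assms, of 1] by simp
  moreover have "sqrt 2 > (1::real)" by simp
  moreover have "gap b 1 = height b 1 - sqrt (1 + (1 - b)) * sqrt 2" by (simp add: gap_def)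
  ultimately show ?thesis by linarith
qed

lemma height_1_ge:
  assumes "0 \<le> b" "b \<le> 1"
  shows "slope b 1 \<le> height b 1"
proof -
  obtain z :: real where z: "0 < z" "z < 1" "height b 1 - height b 0 = (1 - 0) * slope b z"
    using MVT2[of 0 1 "height b" "slope b"] DERIV_height by auto
  then show ?thesis using slope_antimono[OF assms, of z 1] by simp
qed

text \<open>The intermediate value theorem between 1 and \<open>1/\<delta>\<close>. Positivity of
  \<open>b\<close> is essential: \<open>gap 0 x\<close> is -1/x.\<close>

lemma gap_root_exists:
  assumes "0 < b" "b \<le> 1"
  shows "\<exists>x\<ge>1. gap b x = 0"
proof -
  \<comment> \<open>Since \<open>gap b 1 = height b 1 - 2 * slope b 1\<close> and
    \<open>height b 1 \<ge> slope b 1\<close>, this gives \<open>gap b 1 + 1 \<ge> \<delta>\<close>;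
    it is positive because \<open>b > 0\<close>.\<close>
  define \<delta> where "\<delta> = 1 - slope b 1"
  have "(slope b 1)\<^sup>2 < 1\<^sup>2" using slope_square[of b 1] assms by simp
  then have "slope b 1 < 1" by (rule power2_less_imp_less) simp
  then have \<delta>: "0 < \<delta>" "\<delta> < 1" using slope_pos[of b 1] assms by (auto simp: \<delta>_def)
  have sq2: "sqrt 2 * sqrt 2 = (2::real)" by simp
  have s1: "slope b 1 = sqrt (1 + (1 - b)) / sqrt 2" by (simp add: slope_def)
  have "gap b 1 = height b 1 - slope b 1 * 2"
    unfolding s1 gap_def using sq2 by (simp add: field_simps)
  then have g1: "gap b 1 + 1 \<ge> \<delta>" using height_1_ge[of b] assms by (simp add: \<delta>_def)
  \<comment> \<open>The derivative of \<open>gap b\<close> is at least 1/x^2, so adding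
    \<open>inverse x\<close> yields a nondecreasing function. Comparing its values at 1 and
    \<open>1/\<delta>\<close> gives \<open>gap b (1/\<delta>) \<ge> 0\<close>.\<close>
  have "gap b 1 + inverse 1 \<le> gap b (1/\<delta>) + inverse (1/\<delta>)"
  proof (rule DERIV_nonneg_imp_nondecreasing[of 1 "1/\<delta>" "\<lambda>x. gap b x + inverse x"])
    show "1 \<le> 1/\<delta>" using \<delta> by simp
    fix x :: real assume x: "1 \<le> x" "x \<le> 1/\<delta>"
    let ?A = "sqrt (1 + (1 - b) * x\<^sup>2)" and ?w = "sqrt (1 + x\<^sup>2)"
    have "?A \<le> ?w" using assms by (simp add: mult_left_le_one_le)
    then have "?w / ?A / x\<^sup>2 \<ge> 1 / x\<^sup>2"
      using radicand_pos[OF assms(2), of x] by (intro divide_right_mono) auto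
    moreover have "((\<lambda>x. gap b x + inverse x) has_real_derivative (?w / ?A / x\<^sup>2 - 1 / x\<^sup>2)) (at x)"
      using x by (auto intro!: derivative_eq_intros DERIV_gap assms simp: power2_eq_square divide_inverse)
    ultimately show "\<exists>d. ((\<lambda>x. gap b x + inverse x) has_real_derivative d) (at x) \<and> 0 \<le> d"
      by (intro exI conjI) auto
  qed
  then have "gap b (1/\<delta>) \<ge> 0" using g1 by simp
  moreover have "gap b 1 \<le> 0" using gap_1_neg[of b] assms by simp
  moreover have "\<forall>x. 1 \<le> x \<and> x \<le> 1/\<delta> \<longrightarrow> isCont (gap b) x"
    using DERIV_isCont[OF DERIV_gap[OF assms(2)]] by auto
  ultimately show ?thesis using IVT[of "gap b" 1 0 "1/\<delta>"] \<delta> by auto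
qed

text \<open>The bound excludes the mirror root and also 0, where the convention for division by zero
  makes \<open>gap\<close> vanish.\<close>

definition extent :: "real \<Rightarrow> real" where
  "extent b = (SOME x. x \<ge> 1 \<and> gap b x = 0)"

lemma extent_ge_1: "0 < b \<Longrightarrow> b \<le> 1 \<Longrightarrow> 1 \<le> extent b"
  and gap_extent: "0 < b \<Longrightarrow> b \<le> 1 \<Longrightarrow> gap b (extent b) = 0"
  using someI_ex[OF gap_root_exists, of b] by (auto simp: extent_def)

lemma continuous_gap_parameter: "continuous_on {..1} (\<lambda>b. gap b x)"
proof -
  have "continuous_on {..1} (\<lambda>b. height b x)"
    unfolding continuous_on_def
  proof
    fix b :: real assume b: "b \<in> {..1}"
    have "((\<lambda>b'. sqrt \<bar>b' - b\<bar> * \<bar>x\<bar>) \<longlongrightarrow> sqrt \<bar>b - b\<bar> * \<bar>x\<bar>) (at b within {..1})"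
      by (intro tendsto_intros)
    then have lim: "((\<lambda>b'. sqrt \<bar>b' - b\<bar> * \<bar>x\<bar>) \<longlongrightarrow> 0) (at b within {..1})" by simp
    have "\<forall>\<^sub>F b' in at b within {..1}. norm (height b' x - height b x) \<le> sqrt \<bar>b' - b\<bar> * \<bar>x\<bar>"
      unfolding eventually_at_filter using height_diff_le[of _ b x] b by (auto intro!: always_eventually)
    from Lim_null_comparison[OF this lim]
    show "((\<lambda>b. height b x) \<longlongrightarrow> height b x) (at b within {..1})"
      by (rule LIM_zero_cancel)
  qed
  then show ?thesis unfolding gap_def
    by (cases "x = 0") (auto intro!: continuous_intros)
qed

text \<open>The sign of \<open>gap b\<close> at a test point on either side of the root persists for
  nearby parameters, and monotonicity in \<open>x\<close> then keeps their roots on the same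
  side.\<close>

lemma continuous_extent: "continuous_on {0<..1} extent"
  unfolding continuous_on_def
proof
  fix b :: real assume b: "b \<in> {0<..1}"
  let ?F = "at b within {0<..1}"
  have lim: "((\<lambda>b'. gap b' x) \<longlongrightarrow> gap b x) ?F" for x
  proof -
    have "continuous_on {0<..1} (\<lambda>b. gap b x)"
      by (rule continuous_on_subset[OF continuous_gap_parameter]) auto
    then show ?thesis using b unfolding continuous_on_def by blast
  qed
  have in01: "\<forall>\<^sub>F b' in ?F. b' \<in> {0<..1}"
    by (simp add: eventually_at_filter)
  have m: "extent b > 0" using extent_ge_1[of b] b by simp
  show "(extent \<longlongrightarrow> extent b) ?F"
  proof (rule order_tendstoI)
    fix y assume y: "y < extent b"
    \<comment> \<open>The given \<open>y\<close> may be nonpositive; the maximum moves the test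
      point into the range where \<open>gap\<close> is monotone.\<close>
    define z where "z = max y (extent b / 2)"
    have z: "0 < z" "z < extent b" "y \<le> z" using y m by (auto simp: z_def)
    then have "gap b z < 0" using gap_strict_mono[of b z "extent b"] gap_extent[of b] b by simp
    then have "\<forall>\<^sub>F b' in ?F. gap b' z < 0" using lim order_tendstoD(2) by blast
    then show "\<forall>\<^sub>F b' in ?F. y < extent b'" using in01
    proof eventually_elim
      case (elim b')
      have "\<not> extent b' \<le> z"
        using gap_strict_mono[of b' "extent b'" z] elim gap_extent[of b'] extent_ge_1[of b']
        by (cases "extent b' = z") auto
      then show ?case using z by simp
    qed
  next
    fix y assume y: "extent b < y"
    then have "gap b y > 0" using gap_strict_mono[of b "extent b" y] gap_extent[of b] b m by simp
    then have "\<forall>\<^sub>F b' in ?F. gap b' y > 0" using lim order_tendstoD(1) by blast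
    then show "\<forall>\<^sub>F b' in ?F. extent b' < y" using in01
    proof eventually_elim
      case (elim b')
      show ?case
        using gap_strict_mono[of b' y "extent b'"] elim gap_extent[of b'] y m
        by (cases "extent b' = y") (auto simp: not_less_iff_gr_or_eq intro: ccontr)
    qed
  qed
qed

text \<open>For \<open>b = 1\<close> the slope is the derivative of \<open>arsinh\<close>. The
  hyperbolic cosine is taken because it occurs in the equation of the catenoid.\<close>

lemma cosh_height_1: "cosh (height 1 x) = sqrt (1 + x\<^sup>2)"
proof -
  have "\<forall>x. ((\<lambda>x. height 1 x - arsinh x) has_real_derivative 0) (at x)"
  proof
    fix x :: real
    have "slope 1 x = 1 / sqrt (x\<^sup>2 + 1)" by (simp add: slope_def add.commute)
    then show "((\<lambda>x. height 1 x - arsinh x) has_real_derivative 0) (at x)"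
      using DERIV_diff[OF DERIV_height[of 1 x] arsinh_real_has_field_derivative[of x UNIV]] by simp
  qed
  from DERIV_isconst_all[OF this, of x 0] have "height 1 x = arsinh x" by simp
  then show ?thesis using cosh_square_eq[of "arsinh x"] by (simp add: real_sqrt_unique add.commute cosh_real_nonneg)
qed

section \<open>The family of surfaces\<close>

text \<open>With m = \<open>extent b\<close>, the unscaled position vector at x = m is (1 + m^2)/m
  times the unit tangent; \<open>ratio b\<close> is the reciprocal of this factor.\<close>

definition ratio :: "real \<Rightarrow> real" where
  "ratio b = extent b / (1 + (extent b)\<^sup>2)"

definition radius :: "real \<Rightarrow> real \<Rightarrow> real" where
  "radius b s = sqrt b * ratio b * sqrt (1 + s\<^sup>2)"

definition altitude :: "real \<Rightarrow> real \<Rightarrow> real" where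
  "altitude b s = ratio b * height b s"

definition radius' :: "real \<Rightarrow> real \<Rightarrow> real" where
  "radius' b s = sqrt b * ratio b * s / sqrt (1 + s\<^sup>2)"

definition altitude' :: "real \<Rightarrow> real \<Rightarrow> real" where
  "altitude' b s = ratio b * slope b s"

lemma one_plus_square_neq_0 [simp]: "1 + (x::real)\<^sup>2 \<noteq> 0"
  using one_plus_square_pos[of x] by linarith

lemma ratio_pos: "0 < b \<Longrightarrow> b \<le> 1 \<Longrightarrow> 0 < ratio b"
  using extent_ge_1[of b] by (simp add: ratio_def)

lemma ratio_le_1:
  assumes "0 < b" "b \<le> 1"
  shows "ratio b \<le> 1"
proof -
  have "extent b * 1 \<le> extent b * extent b"
    using extent_ge_1[OF assms] by (intro mult_left_mono) auto
  then show ?thesis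
    using one_plus_square_pos[of "extent b"] by (simp add: ratio_def divide_le_eq_1 power2_eq_square)
qed

section \<open>The scaled profile: regularity and behaviour at its end points\<close>

lemma DERIV_sqrt_one_plus_square:
  "((\<lambda>x. sqrt (1 + x\<^sup>2)) has_real_derivative x / sqrt (1 + x\<^sup>2)) (at x)"
  using DERIV_sqrt_radicand[of 0 x] by simp

lemma DERIV_radius: "(radius b has_real_derivative radius' b s) (at s)"
  using DERIV_cmult[OF DERIV_sqrt_one_plus_square, of "sqrt b * ratio b"]
  by (simp add: radius_def[abs_def] radius'_def)

lemma DERIV_altitude: "(altitude b has_real_derivative altitude' b s) (at s)"
  unfolding altitude_def[abs_def] altitude'_def by (rule DERIV_cmult[OF DERIV_height])

lemma smooth_on_sqrt_radicand:
  assumes "b \<le> 1"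
  shows "smooth_on (\<lambda>x. sqrt (1 + (1 - b) * x\<^sup>2)) UNIV"
proof (rule smooth_on_compose[OF open_UNIV open_greaterThan smooth_on_sqrt])
  show "smooth_on (\<lambda>x::real. 1 + (1 - b) * x\<^sup>2) UNIV"
    unfolding power2_eq_square
    by (intro smooth_on_add smooth_on_mult smooth_on_const smooth_on_ident open_UNIV)
qed (use radicand_pos[OF assms] in auto)

lemma smooth_on_slope:
  assumes "b \<le> 1"
  shows "smooth_on (slope b) UNIV"
proof -
  have "smooth_on (\<lambda>x. inverse (sqrt (1 + x\<^sup>2))) UNIV"
    by (rule smooth_on_compose[OF open_UNIV open_greaterThan smooth_on_inverse])
      (use smooth_on_sqrt_radicand[of 0] in auto)
  from smooth_on_mult[OF open_UNIV smooth_on_sqrt_radicand[OF assms] this]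
  show ?thesis by (simp add: slope_def[abs_def] divide_inverse)
qed

lemma smooth_on_radius: "smooth_on (radius b) UNIV"
  unfolding radius_def[abs_def]
  using smooth_on_mult[OF open_UNIV smooth_on_const smooth_on_sqrt_radicand[of 0]] by simp

lemma smooth_on_altitude:
  assumes "b \<le> 1"
  shows "smooth_on (altitude b) UNIV"
proof -
  have "smooth_on (height b) UNIV"
    by (rule smooth_on_real_primitive[OF open_UNIV DERIV_height smooth_on_slope[OF assms]])
  then show ?thesis
    unfolding altitude_def[abs_def] by (intro smooth_on_mult smooth_on_const open_UNIV)
qed

lemma profile_band:
  assumes "0 < b" "b \<le> 1"
  shows "profile (radius b) (altitude b) (radius' b) (altitude' b) (- extent b) (extent b)"
proof
  show "radius b s > 0" "altitude' b s > 0" for s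
    using assms ratio_pos[OF assms] slope_pos[OF assms(2)] by (simp_all add: radius_def altitude'_def)
  show "- extent b < extent b" using extent_ge_1[OF assms] by simp
qed (use assms in \<open>auto intro: smooth_on_radius smooth_on_altitude DERIV_radius DERIV_altitude\<close>)

text \<open>The end points of the profile curve lie on the unit circle, and the unit tangent vector there is
  the position vector.\<close>

lemma radius_extent:
  "radius b (extent b) = sqrt b * (extent b / sqrt (1 + (extent b)\<^sup>2))"
proof -
  have "sqrt (1 + (extent b)\<^sup>2) / (1 + (extent b)\<^sup>2) = 1 / sqrt (1 + (extent b)\<^sup>2)"
    using sqrt_divide_self_eq[of "1 + (extent b)\<^sup>2"] by (simp add: inverse_eq_divide)
  then show ?thesis by (simp add: radius_def ratio_def field_simps)
qed

text \<open>The vanishing of \<open>gap\<close> enters here: it expresses the height at the end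
  point through the two square roots that make up \<open>slope\<close>.\<close>

lemma altitude_extent:
  assumes "0 < b" "b \<le> 1"
  shows "altitude b (extent b) = slope b (extent b)"
proof -
  let ?m = "extent b"
  have m: "?m \<ge> 1" using extent_ge_1[OF assms] .
  have "height b ?m = sqrt (1 + (1 - b) * ?m\<^sup>2) * sqrt (1 + ?m\<^sup>2) / ?m"
    using gap_extent[OF assms] by (simp add: gap_def)
  moreover have "?m / w\<^sup>2 * (A * w / ?m) = A / w" if "w > 0" for A w :: real
    using that m by (simp add: field_simps power2_eq_square)
  from this[of "sqrt (1 + ?m\<^sup>2)" "sqrt (1 + (1 - b) * ?m\<^sup>2)"]
  have "?m / (1 + ?m\<^sup>2) * (sqrt (1 + (1 - b) * ?m\<^sup>2) * sqrt (1 + ?m\<^sup>2) / ?m) = slope b ?m"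
    by (simp add: slope_def)
  ultimately show ?thesis by (simp add: altitude_def ratio_def)
qed

lemma end_point_unit:
  assumes "0 < b" "b \<le> 1"
  shows "(radius b (extent b))\<^sup>2 + (altitude b (extent b))\<^sup>2 = 1"
  using assms unfolding radius_extent altitude_extent[OF assms] slope_square[OF assms(2)]
  by (simp add: power_mult_distrib power_divide)

lemma end_point_tangent:
  assumes "0 < b" "b \<le> 1"
  shows "radius b (extent b) = 1 / ratio b * radius' b (extent b)"
    "altitude b (extent b) = 1 / ratio b * altitude' b (extent b)"
  using ratio_pos[OF assms]
  unfolding radius_extent altitude_extent[OF assms] by (simp_all add: radius'_def altitude'_def)

lemma radius_minus [simp]: "radius b (- s) = radius b s"
  and altitude_minus [simp]: "altitude b (- s) = - altitude b s"
  and radius'_minus [simp]: "radius' b (- s) = - radius' b s"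
  and altitude'_minus [simp]: "altitude' b (- s) = altitude' b s"
  by (simp_all add: radius_def altitude_def radius'_def altitude'_def)

lemma altitude_strict_mono:
  "0 < b \<Longrightarrow> b \<le> 1 \<Longrightarrow> s < t \<Longrightarrow> altitude b s < altitude b t"
  using ratio_pos height_strict_mono by (simp add: altitude_def)

text \<open>Radius and absolute altitude both grow with the absolute value of \<open>s\<close>, the
  radius strictly, and the end points are on the unit circle.\<close>

lemma interior_in_ball:
  assumes "0 < b" "b \<le> 1" "s \<in> {- extent b<..<extent b}"
  shows "(radius b s)\<^sup>2 + (altitude b s)\<^sup>2 < 1"
proof -
  have "\<bar>s\<bar> < extent b" using assms(3) by auto
  then have "s\<^sup>2 < (extent b)\<^sup>2"
    using power_strict_mono[of "\<bar>s\<bar>" "extent b" 2] by simp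
  then have "(radius b s)\<^sup>2 < (radius b (extent b))\<^sup>2"
    using assms ratio_pos[OF assms(1,2)] by (simp add: radius_def power_mult_distrib)
  moreover have "(altitude b s)\<^sup>2 \<le> (altitude b (extent b))\<^sup>2"
    using altitude_strict_mono[OF assms(1,2), of s "extent b"]
      altitude_strict_mono[OF assms(1,2), of "- extent b" s] assms(3)
    by (intro abs_le_square_iff[THEN iffD1]) auto
  ultimately show ?thesis using end_point_unit[OF assms(1,2)] by linarith
qed

text \<open>The segment is put in by hand, because \<open>gap 0\<close> has no positive zero at
  which to cut the profile.\<close>

definition family :: "real \<Rightarrow> (real^3) set" where
  "family b = (if b = 0 then vertical_geodesic
     else rot (radius b) (altitude b) ` (UNIV \<times> {- extent b..extent b}))"

lemma family_eq_band:
  assumes "0 < b" "b \<le> 1"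
  shows "family b = profile.band (radius b) (altitude b) (- extent b) (extent b)"
  using assms profile.band_def[OF profile_band] by (simp add: family_def)

section \<open>Geometric properties of the members with positive parameter\<close>

lemma family_meets_orthogonally:
  assumes "0 < b" "b \<le> 1"
  shows "meets_unit_sphere_orthogonally (family b)"
  unfolding family_eq_band[OF assms]
  using end_point_unit[OF assms] end_point_tangent[OF assms] ratio_pos[OF assms] interior_in_ball[OF assms]
  by (intro profile.meets_unit_sphere_orthogonally_band[OF profile_band[OF assms],
        where k = "1 / ratio b" and l = "1 / ratio b"]) auto

lemma family_subset_cball:
  assumes "0 \<le> b" "b \<le> 1"
  shows "family b \<subseteq> cball 0 1"
proof (cases "b = 0")
  case True
  then show ?thesis by (auto simp: family_def vertical_geodesic_def)
next
  case False
  then have "meets_unit_sphere_orthogonally (family b)"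
    using assms by (intro family_meets_orthogonally) auto
  then show ?thesis
    unfolding meets_unit_sphere_orthogonally_def surface_interior_def by fastforce
qed

text \<open>The arc length of the profile curve is \<open>ratio b * s\<close>.\<close>

lemma family_catenoidal_ricci:
  assumes "0 < b" "b \<le> 1"
  shows "\<exists>r C. catenoidal_ricci b r C \<and> family b \<subseteq> C"
proof (intro exI conjI)
  let ?l = "ratio b" and ?r = "sqrt b * ratio b"
  \<comment> \<open>The parameters are \<open>c = 0\<close> and \<open>d = ?r\<^sup>2\<close>;
    dividing the argument by \<open>?l\<close> passes to arc length.\<close>
  let ?f = "\<lambda>s. sqrt (b * s\<^sup>2 + 2 * 0 * s + ?r\<^sup>2)" and ?g = "\<lambda>s. altitude b (s * (1 / ?l))"
  have l: "?l > 0" and l0: "?l \<noteq> 0" using ratio_pos[OF assms] by auto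
  have f_eq: "?f s = radius b (s * (1 / ?l))" for s
  proof -
    have "b * s\<^sup>2 + 2 * 0 * s + ?r\<^sup>2 = ?r\<^sup>2 * (1 + (s * (1 / ?l))\<^sup>2)"
      using l0 assms by (simp add: power_mult_distrib power_divide distrib_left)
    moreover have "\<bar>?r\<bar> = ?r" using l assms by simp
    ultimately show ?thesis
      by (simp only: radius_def real_sqrt_mult[of "?r\<^sup>2"] real_sqrt_abs)
  qed
  have lin: "smooth_on (\<lambda>s. h (s * (1 / ?l))) UNIV" if "smooth_on h UNIV" for h :: "real \<Rightarrow> real"
    by (rule smooth_on_compose[OF open_UNIV open_UNIV that smooth_on_mult[OF open_UNIV
            smooth_on_ident[OF open_UNIV] smooth_on_const]]) simp
  have dlin: "((\<lambda>s. s * (1 / ?l)) has_real_derivative 1 / ?l) (at s)" for s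
    by (rule DERIV_cong[OF DERIV_cmult_right[OF DERIV_ident]]) simp
  have prof: "rotational_profile UNIV ?f ?g"
    unfolding rotational_profile_def
  proof (intro conjI ballI)
    fix s
    let ?s = "s * (1 / ?l)"
    have df: "deriv ?f s = radius' b ?s * (1 / ?l)"
      unfolding f_eq by (intro DERIV_imp_deriv DERIV_chain2[OF DERIV_radius dlin])
    have dg: "deriv ?g s = altitude' b ?s * (1 / ?l)"
      by (intro DERIV_imp_deriv DERIV_chain2[OF DERIV_altitude dlin])
    show "?f s > 0" unfolding f_eq using l assms by (simp add: radius_def)
    show "deriv ?g s \<ge> 0" unfolding dg using l slope_pos[OF assms(2)] by (simp add: altitude'_def less_imp_le)
    have "radius' b ?s * (1 / ?l) = sqrt b * ?s / sqrt (1 + ?s\<^sup>2)" "altitude' b ?s * (1 / ?l) = slope b ?s"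
      using l by (simp_all add: radius'_def altitude'_def)
    then show "(deriv ?f s)\<^sup>2 + (deriv ?g s)\<^sup>2 = 1"
      unfolding df dg using assms
      by (simp only: slope_square) (simp add: power_mult_distrib power_divide)
  qed (use lin[OF smooth_on_radius] lin[OF smooth_on_altitude[OF assms(2)]] in \<open>simp_all add: f_eq[simplified]\<close>)
  show "catenoidal_ricci b ?r (rotational_surface UNIV ?f ?g)"
    unfolding catenoidal_ricci_def
    by (intro exI[of _ 0] exI[of _ "?r\<^sup>2"] exI[of _ ?f] exI[of _ ?g] conjI prof)
      (use assms l in \<open>auto simp: power_mult_distrib\<close>)
  show "family b \<subseteq> rotational_surface UNIV ?f ?g"
  proof
    fix q assume "q \<in> family b"
    then obtain \<theta> s where q: "q = rot (radius b) (altitude b) (\<theta>, s)"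
      using assms by (auto simp: family_def)
    have "q = vector [?f (?l * s) * cos \<theta>, ?f (?l * s) * sin \<theta>, ?g (?l * s)]"
      unfolding f_eq using l by (simp add: q rot_def)
    then show "q \<in> rotational_surface UNIV ?f ?g"
      unfolding rotational_surface_def by blast
  qed
qed

lemma family_1_critical_catenoid: "critical_catenoid (family 1)"
  unfolding critical_catenoid_def free_boundary_minimal_def
proof (intro conjI)
  let ?l = "ratio 1"
  interpret profile "radius 1" "altitude 1" "radius' 1" "altitude' 1" "- extent 1" "extent 1"
    by (rule profile_band) auto
  have fam: "family 1 = band" by (rule family_eq_band) auto
  have l: "?l > 0" by (rule ratio_pos) auto
  \<comment> \<open>The catenoid about the vertical axis with neck radius
    \<open>ratio 1\<close>.\<close>
  let ?C = "{x :: real^3. sqrt ((x $ 1)\<^sup>2 + (x $ 2)\<^sup>2) = ?l * cosh (x $ 3 / ?l)}"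
  have "catenoid ?C"
    unfolding catenoid_def by (intro exI[of _ ?l] conjI l exI[of _ id]) auto
  moreover have "family 1 \<subseteq> ?C"
  proof
    fix q assume "q \<in> family 1"
    then obtain \<theta> s where q: "q = rot (radius 1) (altitude 1) (\<theta>, s)"
      unfolding fam band_def by auto
    have "(q $ 1)\<^sup>2 + (q $ 2)\<^sup>2 = (radius 1 s)\<^sup>2 * ((cos \<theta>)\<^sup>2 + (sin \<theta>)\<^sup>2)"
      unfolding q rot_nth by algebra
    then have "sqrt ((q $ 1)\<^sup>2 + (q $ 2)\<^sup>2) = radius 1 s" using f_pos[of s] by simp
    also have "\<dots> = ?l * cosh (q $ 3 / ?l)"
      using l by (simp add: q radius_def altitude_def cosh_height_1)
    finally show "q \<in> ?C" by simp
  qed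
  ultimately show "\<exists>C. catenoid C \<and> family 1 \<subseteq> C" by blast
  show "meets_unit_sphere_orthogonally (family 1)" by (rule family_meets_orthogonally) auto
  let ?w = "\<lambda>s. sqrt (1 + s\<^sup>2) :: real"
  have w: "?w s > 0" "(?w s)\<^sup>2 = 1 + s\<^sup>2" for s using less_imp_le[OF one_plus_square_pos[of s]] by auto
  have r': "radius' 1 = (\<lambda>s. ?l * (s / ?w s))" and a': "altitude' 1 = (\<lambda>s. ?l * (1 / ?w s))"
    by (auto simp: radius'_def altitude'_def slope_def)
  have quot: "(1 * v - s * (s / v)) / (v * v) = (v\<^sup>2 - s\<^sup>2) / v ^ 3" if "v > 0" for s v :: real
    using that by (simp add: field_simps power2_eq_square power3_eq_cube)
  have d1: "((\<lambda>s. s / ?w s) has_real_derivative 1 / (?w s) ^ 3) (at s)"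
    and d2: "((\<lambda>s. 1 / ?w s) has_real_derivative - s / (?w s) ^ 3) (at s)" for s
  proof -
    have "((\<lambda>s. s / ?w s) has_real_derivative (1 * ?w s - s * (s / ?w s)) / (?w s * ?w s)) (at s)"
      by (rule DERIV_divide[OF DERIV_ident DERIV_sqrt_one_plus_square]) (use w(1)[of s] in simp)
    moreover have "(1 * ?w s - s * (s / ?w s)) / (?w s * ?w s) = ((?w s)\<^sup>2 - s\<^sup>2) / (?w s) ^ 3"
      using quot[OF w(1)] .
    ultimately show "((\<lambda>s. s / ?w s) has_real_derivative 1 / (?w s) ^ 3) (at s)"
      unfolding w(2) by simp
    have "((\<lambda>s. 1 / ?w s) has_real_derivative (0 * ?w s - 1 * (s / ?w s)) / (?w s * ?w s)) (at s)"
      by (rule DERIV_divide[OF DERIV_const DERIV_sqrt_one_plus_square]) (use w(1)[of s] in simp)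
    moreover have "(0 * ?w s - 1 * (s / ?w s)) / (?w s * ?w s) = - s / (?w s) ^ 3"
      by (simp only: power3_eq_cube mult_zero_left diff_0 mult_1 divide_divide_eq_left minus_divide_left mult.assoc)
    ultimately show "((\<lambda>s. 1 / ?w s) has_real_derivative - s / (?w s) ^ 3) (at s)"
      by (rule DERIV_cong)
  qed
  show "minimal_surface (family 1)"
    unfolding fam
  proof (rule minimal_surface_band)
    show "(radius' 1 has_real_derivative ?l * (1 / (?w s) ^ 3)) (at s)"
      "(altitude' 1 has_real_derivative ?l * (- s / (?w s) ^ 3)) (at s)" for s
      unfolding r' a' by (intro DERIV_cmult d1 d2)+
    fix s
    let ?v = "?w s"
    have v: "?v > 0" "?v\<^sup>2 = 1 + s\<^sup>2" using w[of s] by auto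
    \<comment> \<open>The minimality equation divided by \<open>?l ^ 3\<close>, with the square root
      abstracted to a positive number so that it becomes a rational identity.\<close>
    have "v * (1 / v ^ 3 * (1 / v) - (- s / v ^ 3) * (s / v)) = 1 / v * ((s / v)\<^sup>2 + (1 / v)\<^sup>2)"
      if "v > 0" for v :: real
      using that by (simp add: field_simps power2_eq_square power3_eq_cube)
    from this[OF v(1)]
    have "?v * (1 / ?v ^ 3 * (1 / ?v) - (- s / ?v ^ 3) * (s / ?v)) = 1 / ?v * ((s / ?v)\<^sup>2 + (1 / ?v)\<^sup>2)" .
    then have "?l ^ 3 * (?v * (1 / ?v ^ 3 * (1 / ?v) - (- s / ?v ^ 3) * (s / ?v))) =
      ?l ^ 3 * (1 / ?v * ((s / ?v)\<^sup>2 + (1 / ?v)\<^sup>2))" by simp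
    then show "radius 1 s * (?l * (1 / ?v ^ 3) * altitude' 1 s - ?l * (- s / ?v ^ 3) * radius' 1 s) =
       altitude' 1 s * ((radius' 1 s)\<^sup>2 + (altitude' 1 s)\<^sup>2)"
      unfolding r' a' radius_def by (simp add: algebra_simps power2_eq_square power3_eq_cube)
  qed
qed

section \<open>Hausdorff continuity at positive parameters\<close>

lemma dist_rot_le:
  "dist (rot f g (\<theta>, s)) (rot f1 g1 (\<theta>, s1)) \<le> \<bar>f s - f1 s1\<bar> + \<bar>g s - g1 s1\<bar>"
proof -
  let ?e = "vector [cos \<theta>, sin \<theta>, 0] :: real^3" and ?z = "vector [0, 0, 1] :: real^3"
  \<comment> \<open>Points with equal angle lie in a common vertical plane, where the coordinate
    differences bound the distance.\<close>
  have "rot f g (\<theta>, s) - rot f1 g1 (\<theta>, s1) = (f s - f1 s1) *\<^sub>R ?e + (g s - g1 s1) *\<^sub>R ?z"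
    by (simp add: vec3_eq_iff algebra_simps)
  moreover have "norm ?e = 1" "norm ?z = 1"
    by (simp_all add: norm_eq_sqrt_inner inner_vec3 flip: power2_eq_square)
  ultimately show ?thesis
    unfolding dist_norm using norm_triangle_ineq[of "(f s - f1 s1) *\<^sub>R ?e" "(g s - g1 s1) *\<^sub>R ?z"] by simp
qed

text \<open>The root is the norm of the pair (1, x), so this is the reverse triangle
  inequality.\<close>

lemma sqrt_one_plus_square_lipschitz: "\<bar>sqrt (1 + x\<^sup>2) - sqrt (1 + y\<^sup>2)\<bar> \<le> \<bar>x - y\<bar>" for x y :: real
  using norm_triangle_ineq3[of "(1::real, x)" "(1, y)"] by (simp add: norm_Pair)

text \<open>A normalised parameter makes members of different extent comparable point by
  point.\<close>

lemma family_eq: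
  assumes "0 < b" "b \<le> 1"
  shows "family b = {rot (radius b) (altitude b) (\<theta>, t * extent b) |\<theta> t. \<bar>t\<bar> \<le> 1}"
proof -
  have m: "extent b > 0" using extent_ge_1[OF assms] by simp
  have "s \<in> {- extent b..extent b} \<longleftrightarrow> (\<exists>t. \<bar>t\<bar> \<le> 1 \<and> s = t * extent b)" for s
  proof
    assume "s \<in> {- extent b..extent b}"
    then show "\<exists>t. \<bar>t\<bar> \<le> 1 \<and> s = t * extent b"
      using m by (intro exI[of _ "s / extent b"]) (auto simp: abs_le_iff field_simps)
  next
    assume "\<exists>t. \<bar>t\<bar> \<le> 1 \<and> s = t * extent b"
    then obtain t where t: "\<bar>t\<bar> \<le> 1" "s = t * extent b" by blast
    then have "\<bar>s\<bar> \<le> 1 * extent b" unfolding abs_mult t(2) using m by (intro mult_mono) auto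
    then show "s \<in> {- extent b..extent b}" by auto
  qed
  then show ?thesis using assms unfolding family_def by fastforce
qed

text \<open>The first line bounds the change of radius, the second that of altitude, for all angles
  and all normalised parameters. The bound is 0 at \<open>b' = b\<close>.\<close>

definition family_bound :: "real \<Rightarrow> real \<Rightarrow> real" where
  "family_bound b b' =
     \<bar>sqrt b * ratio b - sqrt b' * ratio b'\<bar> * sqrt (1 + (extent b)\<^sup>2) + \<bar>extent b - extent b'\<bar> +
     (\<bar>ratio b - ratio b'\<bar> * extent b + (sqrt \<bar>b - b'\<bar> * extent b + \<bar>extent b - extent b'\<bar>))"

lemma dist_family_le:
  assumes b: "0 < b" "b \<le> 1" and b': "0 < b'" "b' \<le> 1" and t: "\<bar>t\<bar> \<le> 1"
  shows "dist (rot (radius b) (altitude b) (\<theta>, t * extent b))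
    (rot (radius b') (altitude b') (\<theta>, t * extent b')) \<le> family_bound b b'"
proof -
  let ?m = "extent b" and ?m' = "extent b'" and ?w = "\<lambda>x::real. sqrt (1 + x\<^sup>2)"
  let ?x = "t * ?m" and ?x' = "t * ?m'"
  have m: "?m > 0" using extent_ge_1[OF b] by simp
  have x: "\<bar>?x\<bar> \<le> ?m" using mult_mono[OF t order_refl[of ?m]] m by (simp add: abs_mult)
  have xx: "\<bar>?x - ?x'\<bar> \<le> \<bar>?m - ?m'\<bar>"
    using mult_mono[OF t order_refl[of "\<bar>?m - ?m'\<bar>"]] by (simp add: abs_mult flip: right_diff_distrib)
  have l': "0 < ratio b'" "ratio b' \<le> 1" using ratio_pos[OF b'] ratio_le_1[OF b'] by auto
  have wx: "?w ?x \<le> ?w ?m" using x m by (simp add: abs_le_square_iff[symmetric])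
  \<comment> \<open>The scaling factor is changed first and the profile point second; the altitude
    below is split in the same way.\<close>
  have "radius b ?x - radius b' ?x' =
    (sqrt b * ratio b - sqrt b' * ratio b') * ?w ?x + sqrt b' * ratio b' * (?w ?x - ?w ?x')"
    by (simp add: radius_def algebra_simps)
  also have "\<bar>\<dots>\<bar> \<le> \<bar>sqrt b * ratio b - sqrt b' * ratio b'\<bar> * ?w ?m + 1 * \<bar>?m - ?m'\<bar>"
  proof (rule order_trans[OF abs_triangle_ineq], rule add_mono)
    show "\<bar>(sqrt b * ratio b - sqrt b' * ratio b') * ?w ?x\<bar> \<le> \<bar>sqrt b * ratio b - sqrt b' * ratio b'\<bar> * ?w ?m"
      unfolding abs_mult using wx by (intro mult_mono) (auto simp: abs_of_pos)
    have "sqrt b' * ratio b' \<le> 1" using b' l' by (intro mult_le_one) auto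
    moreover have "\<bar>?w ?x - ?w ?x'\<bar> \<le> \<bar>?m - ?m'\<bar>"
      using sqrt_one_plus_square_lipschitz[of ?x ?x'] xx by linarith
    ultimately show "\<bar>sqrt b' * ratio b' * (?w ?x - ?w ?x')\<bar> \<le> 1 * \<bar>?m - ?m'\<bar>"
      unfolding abs_mult[of "sqrt b' * ratio b'"] using b' l' by (intro mult_mono) auto
  qed
  finally have R: "\<bar>radius b ?x - radius b' ?x'\<bar> \<le>
    \<bar>sqrt b * ratio b - sqrt b' * ratio b'\<bar> * ?w ?m + \<bar>?m - ?m'\<bar>" by simp
  have "\<bar>height b ?x - height b' ?x'\<bar> \<le> \<bar>height b ?x - height b' ?x\<bar> + \<bar>height b' ?x - height b' ?x'\<bar>"
    by simp
  also have "\<dots> \<le> sqrt \<bar>b - b'\<bar> * \<bar>?x\<bar> + \<bar>?x - ?x'\<bar>"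
    using b b' by (intro add_mono height_diff_le height_lipschitz) auto
  also have "\<dots> \<le> sqrt \<bar>b - b'\<bar> * ?m + \<bar>?m - ?m'\<bar>"
    using x xx by (intro add_mono mult_left_mono) auto
  finally have h: "\<bar>height b ?x - height b' ?x'\<bar> \<le> sqrt \<bar>b - b'\<bar> * ?m + \<bar>?m - ?m'\<bar>" .
  have "altitude b ?x - altitude b' ?x' =
    (ratio b - ratio b') * height b ?x + ratio b' * (height b ?x - height b' ?x')"
    by (simp add: altitude_def algebra_simps)
  also have "\<bar>\<dots>\<bar> \<le> \<bar>ratio b - ratio b'\<bar> * ?m + 1 * (sqrt \<bar>b - b'\<bar> * ?m + \<bar>?m - ?m'\<bar>)"
  proof (rule order_trans[OF abs_triangle_ineq], rule add_mono)
    have "\<bar>height b ?x\<bar> \<le> ?m" using abs_height_le[of b ?x] b x by linarith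
    then show "\<bar>(ratio b - ratio b') * height b ?x\<bar> \<le> \<bar>ratio b - ratio b'\<bar> * ?m"
      unfolding abs_mult by (intro mult_left_mono) auto
    show "\<bar>ratio b' * (height b ?x - height b' ?x')\<bar> \<le> 1 * (sqrt \<bar>b - b'\<bar> * ?m + \<bar>?m - ?m'\<bar>)"
      unfolding abs_mult using l' h by (intro mult_mono) auto
  qed
  finally have "\<bar>altitude b ?x - altitude b' ?x'\<bar> \<le>
    \<bar>ratio b - ratio b'\<bar> * ?m + (sqrt \<bar>b - b'\<bar> * ?m + \<bar>?m - ?m'\<bar>)" by simp
  then show ?thesis
    using R dist_rot_le[of "radius b" "altitude b" \<theta> ?x "radius b'" "altitude b'" ?x']
    unfolding family_bound_def by linarith
qed

lemma continuous_family_bound: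
  assumes "0 < b" "b \<le> 1"
  shows "continuous_on {0<..1} (family_bound b)"
proof -
  have "continuous_on {0<..1} ratio"
    unfolding ratio_def[abs_def] by (intro continuous_intros continuous_extent) auto
  then show ?thesis
    unfolding family_bound_def[abs_def] by (intro continuous_intros continuous_extent) auto
qed

lemma family_near_positive:
  assumes b: "0 < b" "b \<le> 1" and e: "\<epsilon> > 0"
  shows "\<exists>\<delta>>0. \<forall>b'\<in>{0..1}. \<bar>b' - b\<bar> < \<delta> \<longrightarrow>
    family b' \<subseteq> (\<Union>x\<in>family b. ball x \<epsilon>) \<and> family b \<subseteq> (\<Union>x\<in>family b'. ball x \<epsilon>)"
proof -
  obtain d where d: "d > 0"
    "\<And>b'. b' \<in> {0<..1} \<Longrightarrow> dist b' b < d \<Longrightarrow> dist (family_bound b b') (family_bound b b) < \<epsilon>"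
    using continuous_family_bound[OF b] b e unfolding continuous_on_iff
    by (metis greaterThanAtMost_iff)
  \<comment> \<open>The bound by \<open>b\<close> keeps \<open>b'\<close> positive, so the
    degenerate member is never met here.\<close>
  have "family b' \<subseteq> (\<Union>x\<in>family b. ball x \<epsilon>) \<and> family b \<subseteq> (\<Union>x\<in>family b'. ball x \<epsilon>)"
    if "b' \<in> {0..1}" "\<bar>b' - b\<bar> < min d b" for b'
  proof -
    have b': "0 < b'" "b' \<le> 1" using that by auto
    have "family_bound b b' < \<epsilon>"
      using d(2)[of b'] b' that by (simp add: dist_real_def family_bound_def[of b b])
    then have lt: "dist (rot (radius b) (altitude b) (\<theta>, t * extent b))
      (rot (radius b') (altitude b') (\<theta>, t * extent b')) < \<epsilon>" if "\<bar>t\<bar> \<le> 1" for \<theta> t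
      using dist_family_le[OF b b' that, of \<theta>] by linarith
    show ?thesis
      unfolding family_eq[OF b] family_eq[OF b']
    proof (intro conjI subsetI)
      fix q assume "q \<in> {rot (radius b') (altitude b') (\<theta>, t * extent b') |\<theta> t. \<bar>t\<bar> \<le> 1}"
      then obtain \<theta> t where q: "q = rot (radius b') (altitude b') (\<theta>, t * extent b')" "\<bar>t\<bar> \<le> 1" by blast
      then have "q \<in> ball (rot (radius b) (altitude b) (\<theta>, t * extent b)) \<epsilon>" using lt by simp
      then show "q \<in> (\<Union>x\<in>{rot (radius b) (altitude b) (\<theta>, t * extent b) |\<theta> t. \<bar>t\<bar> \<le> 1}. ball x \<epsilon>)"
        using q(2) by blast
    next
      fix q assume "q \<in> {rot (radius b) (altitude b) (\<theta>, t * extent b) |\<theta> t. \<bar>t\<bar> \<le> 1}"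
      then obtain \<theta> t where q: "q = rot (radius b) (altitude b) (\<theta>, t * extent b)" "\<bar>t\<bar> \<le> 1" by blast
      then have "q \<in> ball (rot (radius b') (altitude b') (\<theta>, t * extent b')) \<epsilon>"
        using lt by (simp add: dist_commute)
      then show "q \<in> (\<Union>x\<in>{rot (radius b') (altitude b') (\<theta>, t * extent b') |\<theta> t. \<bar>t\<bar> \<le> 1}. ball x \<epsilon>)"
        using q(2) by blast
    qed
  qed
  then show ?thesis using d(1) b by (intro exI[of _ "min d b"]) auto
qed

section \<open>Degeneration to the vertical segment\<close>

lemma radius_le_sqrt:
  assumes b: "0 < b" "b \<le> 1" and s: "s \<in> {- extent b..extent b}"
  shows "radius b s \<le> sqrt b"
proof -
  have m: "extent b \<ge> 1" using extent_ge_1[OF b] .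
  have "s\<^sup>2 \<le> (extent b)\<^sup>2" using s m by (intro abs_le_square_iff[THEN iffD1]) auto
  then have "radius b s \<le> radius b (extent b)"
    unfolding radius_def using b ratio_pos[OF b] by (intro mult_left_mono) auto
  also have "\<dots> \<le> sqrt b * 1"
    unfolding radius_extent
  proof (intro mult_left_mono)
    have "extent b \<le> sqrt (1 + (extent b)\<^sup>2)" by (rule real_le_rsqrt) simp
    then show "extent b / sqrt (1 + (extent b)\<^sup>2) \<le> 1" by simp
  qed (use b in auto)
  finally show ?thesis by simp
qed

text \<open>This altitude equals the slope, a number between 0 and 1, hence is at least its own
  square, which is at least \<open>1 - b\<close>.\<close>

lemma altitude_extent_ge:
  assumes b: "0 < b" "b \<le> 1"
  shows "1 - b \<le> altitude b (extent b)"
proof -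
  have "b * ((extent b)\<^sup>2 / (1 + (extent b)\<^sup>2)) \<le> b * 1"
    using b by (intro mult_left_mono) auto
  then have "1 - b \<le> (slope b (extent b))\<^sup>2" using slope_square[OF b(2)] by simp
  also have "\<dots> \<le> slope b (extent b)"
    using slope_le_1[of b "extent b"] slope_pos[of b "extent b"] b by (simp add: power2_eq_square mult_left_le)
  finally show ?thesis using altitude_extent[OF b] by simp
qed

lemma vertical_geodesic_eq: "vertical_geodesic = {vector [0, 0, z] |z. \<bar>z\<bar> \<le> 1}"
proof (intro equalityI subsetI)
  fix q :: "real^3" assume "q \<in> vertical_geodesic"
  then have q: "norm q \<le> 1" "q = vector [0, 0, q $ 3]"
    by (auto simp: vertical_geodesic_def vec3_eq_iff)
  then have "\<bar>q $ 3\<bar> \<le> 1" using component_le_norm_cart[of q 3] by linarith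
  then show "q \<in> {vector [0, 0, z] |z. \<bar>z\<bar> \<le> 1}" using q(2) by blast
next
  fix q :: "real^3" assume "q \<in> {vector [0, 0, z] |z. \<bar>z\<bar> \<le> 1}"
  then show "q \<in> vertical_geodesic"
    by (auto simp: vertical_geodesic_def norm_eq_sqrt_inner inner_vec3 abs_square_le_1 simp flip: power2_eq_square)
qed

lemma family_near_zero:
  assumes e: "\<epsilon> > 0"
  shows "\<exists>\<delta>>0. \<forall>b\<in>{0..1}. \<bar>b - 0\<bar> < \<delta> \<longrightarrow>
    family b \<subseteq> (\<Union>x\<in>family 0. ball x \<epsilon>) \<and> family 0 \<subseteq> (\<Union>x\<in>family b. ball x \<epsilon>)"
\<comment> \<open>This choice gives \<open>sqrt b < \<epsilon>/2\<close>, and both the horizontal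
  error, at most \<open>sqrt b\<close>, and the vertical error, at most
  \<open>b \<le> sqrt b\<close>, stay below half of \<epsilon>.\<close>
proof (intro exI[of _ "(\<epsilon>/2)\<^sup>2"] conjI ballI impI)
  show "(\<epsilon>/2)\<^sup>2 > 0" using e by simp
  fix b :: real assume "b \<in> {0..1}" and small: "\<bar>b - 0\<bar> < (\<epsilon>/2)\<^sup>2"
  then consider "b = 0" | "0 < b" "b \<le> 1" by force
  then have "family b \<subseteq> (\<Union>x\<in>family 0. ball x \<epsilon>) \<and> family 0 \<subseteq> (\<Union>x\<in>family b. ball x \<epsilon>)"
  proof cases
    case 1
    then show ?thesis using e by auto
  next
    case b: 2
    interpret profile "radius b" "altitude b" "radius' b" "altitude' b" "- extent b" "extent b"
      by (rule profile_band[OF b])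
    \<comment> \<open>The axis is written as a rotational surface of radius 0 so that
      \<open>dist_rot_le\<close> applies to it.\<close>
    let ?m = "extent b" and ?axis = "rot (\<lambda>s. 0) (\<lambda>s. s)"
    have fam: "family b = rot (radius b) (altitude b) ` (UNIV \<times> {- ?m..?m})"
      using b by (simp add: family_def)
    have axis: "?axis (\<theta>, z) = vector [0, 0, z]" for \<theta> z by (simp add: rot_def)
    have fam0: "family 0 = {vector [0, 0, z] |z. \<bar>z\<bar> \<le> 1}"
      by (simp add: family_def vertical_geodesic_eq)
    have sq: "sqrt b < \<epsilon>/2" using small e b by (intro real_less_lsqrt) auto
    have "b * b \<le> b" using b by simp
    then have b_le: "b \<le> sqrt b" using b by (intro real_le_rsqrt) (simp add: power2_eq_square)
    have r: "0 < radius b s" "radius b s \<le> sqrt b" if "s \<in> {- ?m..?m}" for s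
      using f_pos radius_le_sqrt[OF b that] by auto
    have m: "- ?m \<le> ?m" using extent_ge_1[OF b] by simp
    have "(altitude b ?m)\<^sup>2 \<le> 1"
      using end_point_unit[OF b] zero_le_power2[of "radius b ?m"] by linarith
    then have top: "altitude b ?m \<le> 1" by (simp add: abs_square_le_1)
    have top0: "0 \<le> altitude b ?m" using altitude_extent_ge[OF b] b by simp
    show ?thesis
    proof (intro conjI subsetI)
      fix q assume "q \<in> family b"
      then obtain \<theta> s where q: "q = rot (radius b) (altitude b) (\<theta>, s)" and s: "s \<in> {- ?m..?m}"
        unfolding fam by auto
      have "altitude b (- ?m) \<le> altitude b s" "altitude b s \<le> altitude b ?m"
        using s strict_mono_less_eq[OF g_strict_mono, of "- ?m" s]
          strict_mono_less_eq[OF g_strict_mono, of s ?m] by auto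
      then have "\<bar>altitude b s\<bar> \<le> 1" using top by simp
      moreover have "dist q (?axis (\<theta>, altitude b s)) < \<epsilon>"
        using dist_rot_le[of "radius b" "altitude b" \<theta> s "\<lambda>s. 0" "\<lambda>s. s" "altitude b s"] r[OF s] sq e
        unfolding q by simp
      ultimately show "q \<in> (\<Union>x\<in>family 0. ball x \<epsilon>)"
        unfolding fam0 axis by (auto simp: dist_commute)
    next
      fix q assume "q \<in> family 0"
      then obtain z where q: "q = vector [0, 0, z]" and z: "\<bar>z\<bar> \<le> 1" unfolding fam0 by auto
      \<comment> \<open>Shrinking \<open>z\<close> by the top altitude puts it into the range of
        altitudes, so that the intermediate value theorem yields a profile point; the vertical error
        is at most \<open>1 - altitude b ?m\<close>, hence at most \<open>b\<close>.\<close>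
      have zt: "\<bar>z * altitude b ?m\<bar> \<le> altitude b ?m"
        using z top0 by (simp add: abs_mult mult_left_le_one_le)
      then have "altitude b (- ?m) \<le> z * altitude b ?m" "z * altitude b ?m \<le> altitude b ?m"
        unfolding altitude_minus by linarith+
      from IVT'[OF this m continuous_g]
      obtain s where s: "s \<in> {- ?m..?m}" "altitude b s = z * altitude b ?m" by auto
      have "z - altitude b s = z * (1 - altitude b ?m)"
        unfolding s(2) by (simp add: algebra_simps)
      then have "\<bar>z - altitude b s\<bar> = \<bar>z\<bar> * (1 - altitude b ?m)"
        using top by (simp add: abs_mult)
      also have "\<dots> \<le> 1 * b" using z top altitude_extent_ge[OF b] by (intro mult_mono) auto
      finally have "dist (?axis (0, z)) (rot (radius b) (altitude b) (0, s)) < \<epsilon>"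
        using dist_rot_le[of "\<lambda>s. 0" "\<lambda>s. s" 0 z "radius b" "altitude b" s] r[OF s(1)] sq b_le
        by simp
      then show "q \<in> (\<Union>x\<in>family b. ball x \<epsilon>)"
        unfolding fam q axis using s(1)
        by (intro UN_I[of "rot (radius b) (altitude b) (0, s)"] imageI) (auto simp: dist_commute)
    qed
  qed
  then show "family b \<subseteq> (\<Union>x\<in>family 0. ball x \<epsilon>)" "family 0 \<subseteq> (\<Union>x\<in>family b. ball x \<epsilon>)"
    by auto
qed

lemma hausdorff_continuous_family: "hausdorff_continuous_on {0..1} family"
  unfolding hausdorff_continuous_on_def
proof (intro ballI allI impI)
  fix b \<epsilon> :: real assume "b \<in> {0..1}" "\<epsilon> > 0"
  then consider "b = 0" | "0 < b" "b \<le> 1" by force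
  then show "\<exists>\<delta>>0. \<forall>b'\<in>{0..1}. \<bar>b' - b\<bar> < \<delta> \<longrightarrow>
        family b' \<subseteq> (\<Union>x\<in>family b. ball x \<epsilon>) \<and> family b \<subseteq> (\<Union>x\<in>family b'. ball x \<epsilon>)"
    using family_near_zero[OF \<open>\<epsilon> > 0\<close>] family_near_positive[OF _ _ \<open>\<epsilon> > 0\<close>] by cases blast+
qed

theorem theorem4p2:
  shows "\<exists>\<Sigma> :: real \<Rightarrow> (real^3) set.
     hausdorff_continuous_on {0..1} \<Sigma> \<and>
     (\<forall>b\<in>{0..1}. \<Sigma> b \<subseteq> cball 0 1) \<and>
     \<Sigma> 0 = vertical_geodesic \<and>
     (\<forall>b\<in>{0<..1}. (\<exists>r C. catenoidal_ricci b r C \<and> \<Sigma> b \<subseteq> C) \<and>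
        meets_unit_sphere_orthogonally (\<Sigma> b)) \<and>
     critical_catenoid (\<Sigma> 1)"
proof (intro exI[of _ family] conjI ballI)
  show "hausdorff_continuous_on {0..1} family" by (rule hausdorff_continuous_family)
  show "family b \<subseteq> cball 0 1" if "b \<in> {0..1}" for b
    using family_subset_cball that by simp
  show "family 0 = vertical_geodesic" by (simp add: family_def)
  show "\<exists>r C. catenoidal_ricci b r C \<and> family b \<subseteq> C" if "b \<in> {0<..1}" for b
    using family_catenoidal_ricci that by simp
  show "meets_unit_sphere_orthogonally (family b)" if "b \<in> {0<..1}" for b
    using family_meets_orthogonally that by simp
  show "critical_catenoid (family 1)" by (rule family_1_critical_catenoid)
qed

end
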